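(* Let $a, b$ be relatively prime positive integers such that $\frac{9}{7} < \frac{a}{b} < \frac{4}{3}$ and $\gcd(b, 24) = 1$. Let $\varphi$ be the morphism on $\mathbb{Z}_{\geq 0} \cup \{0'\}$ defined for $n \in \mathbb{Z}_{\geq 0}$ by $\varphi(n) = 0^{a-b-1} 1\, 0^{2a-2b-1} 1\, 0^{-a+2b-1} 1\, 0^{2a-2b-1} 1\, 0^{a-b-1} 1\, 0^{-2a+3b-1} 1\, 0^{4a-5b-1} 1\, 0^{-a+2b-1} 1\, 0^{2a-2b-1} 1\, 0^{a-b-1} 1\, 0^{-2a+3b-1} 1\, 0^{-2a+3b-1} 1\, 0^{5a-6b-1} 1\, 0^{-2a+3b-1} 1\, 0^{4a-5b-1} 1\, 0^{a-b-1} 1\, 0^{-2a+3b-1} 1\, 0^{3a-3b-1} 1\, 0^{-2a+3b-1} 1\, 0^{a-b-1} 1\, 0^{-3a+4b-1} 1\, 0^{5a-6b-1} 1\, 0^{2a-2b-1} 1\, 0^{a-b-1} 1\, 0^{-2a+3b-1} 1\, 0^{3a-3b-1} 1\, 0^{-2a+3b-1} 1\, 0^{4a-5b-1} 1\, 0^{a-b-1} 1\, 0^{-2a+3b-1} 1\, 0^{2a-2b-1} 2\, 0^{a-b-1} 1\, 0^{-2a+3b-1} 1\, 0^{3a-3b-1} 1\, 0^{-2a+3b-1} 1\, 0^{a-b-1} 1\, 0^{a-b-1}\, (n+2)$ (a $(24a-15b)$-uniform map on $\mathbb{Z}_{\geq 0}$), and by $\varphi(0') = v\,\varphi(0)$,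 where $v = 0' \, 0^{a-2} \, 1 \, 0^{a-b-1} \, 1 \, 0^{a-b-1} \, 1$. Then $\textbf{w}_{a/b} = \tau(\varphi^\infty(0'))$. In particular, $\rho(\frac{a}{b}) = 24a-15b$.
   Context: Words are indexed from position $0$; a factor is a contiguous subword; $c^m$ denotes $m$ copies of the letter $c$. For relatively prime positive integers $a,b$ and a nonempty word $v$ whose length is divisible by $b$, define $v^{a/b} = v^{\lfloor a/b \rfloor} v_0 v_1 \cdots v_{t-1}$, where $t = |v|\,(a/b - \lfloor a/b\rfloor)$; such a word is called an $\frac{a}{b}$-power. A word is $\frac{a}{b}$-power-free if none of its factors is an $\frac{a}{b}$-power. For $\frac{a}{b} > 1$, $\textbf{w}_{a/b}$ denotes the lexicographically least infinite word over $\mathbb{Z}_{\geq 0}$ that is $\frac{a}{b}$-power-free. A morphism $\varphi$ on $\Sigma$ is a map $\Sigma \to \Sigma^*$ extended by concatenation; if $\varphi(c)$ begins with $c$, $\varphi^\infty(c)$ is the infinite fixed point beginning with $c$. Here $0'$ is a new letter not in $\mathbb{Z}_{\geq 0}$ and $\tau$ is the coding with $\tau(0')=0$, $\tau(n)=n$ for $n\in\mathbb{Z}_{\geq 0}$. For $k \geq 2$, an integer sequence $s(i)_{i\ge0}$ is $k$-regular if the $\mathbb{Z}$-module generated by $\{ s(k^e i + j)_{i \geq 0} : e \geq 0,\ 0 \leq j \leq k^e - 1 \}$ is finitely generated. Integers $k,l\ge 2$ are multiplicatively dependent ($k\sim l$) if $k^s=l^t$ for some positive integers $s,t$. When nonempty,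 the set of $k\ge2$ for which the letter sequence of $\textbf{w}_{a/b}$ is $k$-regular is a single $\sim$-class, denoted $\rho(\frac{a}{b})$; writing $\rho(\frac{a}{b}) = k$ means $k$ belongs to this class. *)

theory Defs
  imports
    Complex_Main
    "HOL-Library.Stream"
    "HOL-Library.Sublist"
    "HOL-Library.Function_Algebras"
begin

(* Finite words are lists and infinite words are streams; both are indexed from 0. *)

section \<open>Fractional powers and the lexicographically least power-free word\<close>

(* v ^ (a/b) for b dividing |v|:  floor (a/b) = a div b, and
   t = |v| * (a/b - floor (a/b)) = |v| * (a mod b) / b, where the division is exact. *)
definition frac_pow :: "nat \<Rightarrow> nat \<Rightarrow> 'a list \<Rightarrow> 'a list" where
  "frac_pow a b v =
     concat (replicate (a div b) v) @ take (length v * (a mod b) div b) v"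

definition is_frac_power :: "nat \<Rightarrow> nat \<Rightarrow> 'a list \<Rightarrow> bool" where
  "is_frac_power a b u \<longleftrightarrow> (\<exists>v. v \<noteq> [] \<and> b dvd length v \<and> u = frac_pow a b v)"

definition factor :: "'a list \<Rightarrow> 'a stream \<Rightarrow> bool" where
  "factor u x \<longleftrightarrow> (\<exists>i n. u = stake n (sdrop i x))"

definition power_free :: "nat \<Rightarrow> nat \<Rightarrow> 'a stream \<Rightarrow> bool" where
  "power_free a b x \<longleftrightarrow> (\<forall>u. factor u x \<longrightarrow> \<not> is_frac_power a b u)"

definition lex_less :: "'a::linorder stream \<Rightarrow> 'a stream \<Rightarrow> bool" where
  "lex_less x y \<longleftrightarrow> (\<exists>n. stake n x = stake n y \<and> x !! n < y !! n)"

(* Meaningful for coprime positive a, b with a/b > 1. *)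
definition w :: "nat \<Rightarrow> nat \<Rightarrow> nat stream" where
  "w a b = (THE x. power_free a b x \<and> (\<forall>y. power_free a b y \<longrightarrow> x = y \<or> lex_less x y))"

section \<open>Morphisms and their fixed points\<close>

(* The infinite fixed point beginning with c.  The library function flat concatenates a stream of
   nonempty lists, so this is meant for non-erasing morphisms f such that f c begins with c and
   has length at least 2. *)
definition morph_fix :: "('a \<Rightarrow> 'a list) \<Rightarrow> 'a \<Rightarrow> 'a stream" where
  "morph_fix f c = (THE x. shd x = c \<and> flat (smap f x) = x)"

(* The alphabet of the nonnegative integers together with a new letter 0'. *)
datatype letter = ZeroPrime | Num nat

fun tau :: "letter \<Rightarrow> nat" where
  "tau ZeroPrime = 0"
| "tau (Num n) = n"

(* A pair (k, c) stands for the word 0^k c.  The exponents are natural numbers; for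
   9/7 < a/b < 4/3 no subtraction below is truncated. *)
definition blocks :: "(nat \<times> nat) list \<Rightarrow> letter list" where
  "blocks ps = concat (map (\<lambda>(k, c). replicate k (Num 0) @ [Num c]) ps)"

definition phi_num :: "nat \<Rightarrow> nat \<Rightarrow> nat \<Rightarrow> letter list" where
  "phi_num a b n = blocks
    [(a - b - 1, 1), (2*a - 2*b - 1, 1), (2*b - a - 1, 1), (2*a - 2*b - 1, 1),
     (a - b - 1, 1), (3*b - 2*a - 1, 1), (4*a - 5*b - 1, 1), (2*b - a - 1, 1),
     (2*a - 2*b - 1, 1), (a - b - 1, 1), (3*b - 2*a - 1, 1), (3*b - 2*a - 1, 1),
     (5*a - 6*b - 1, 1), (3*b - 2*a - 1, 1), (4*a - 5*b - 1, 1), (a - b - 1, 1),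
     (3*b - 2*a - 1, 1), (3*a - 3*b - 1, 1), (3*b - 2*a - 1, 1), (a - b - 1, 1),
     (4*b - 3*a - 1, 1), (5*a - 6*b - 1, 1), (2*a - 2*b - 1, 1), (a - b - 1, 1),
     (3*b - 2*a - 1, 1), (3*a - 3*b - 1, 1), (3*b - 2*a - 1, 1), (4*a - 5*b - 1, 1),
     (a - b - 1, 1), (3*b - 2*a - 1, 1), (2*a - 2*b - 1, 2), (a - b - 1, 1),
     (3*b - 2*a - 1, 1), (3*a - 3*b - 1, 1), (3*b - 2*a - 1, 1), (a - b - 1, 1),
     (a - b - 1, n + 2)]"

fun phi :: "nat \<Rightarrow> nat \<Rightarrow> letter \<Rightarrow> letter list" where
  "phi a b (Num n) = phi_num a b n"
| "phi a b ZeroPrime =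
     (ZeroPrime # blocks [(a - 2, 1), (a - b - 1, 1), (a - b - 1, 1)]) @ phi_num a b 0"

section \<open>Regular sequences\<close>

(* Integer sequences as a module over the integers; addition is pointwise. *)
definition seq_scale :: "int \<Rightarrow> (nat \<Rightarrow> int) \<Rightarrow> nat \<Rightarrow> int" where
  "seq_scale c s = (\<lambda>i. c * s i)"

global_interpretation int_seq: module seq_scale
  by standard (auto simp: seq_scale_def fun_eq_iff algebra_simps)

definition kernel :: "nat \<Rightarrow> (nat \<Rightarrow> int) \<Rightarrow> (nat \<Rightarrow> int) set" where
  "kernel k s = {(\<lambda>i. s (k ^ e * i + j)) | e j. j \<le> k ^ e - 1}"

definition k_regular :: "nat \<Rightarrow> (nat \<Rightarrow> int) \<Rightarrow> bool" where
  "k_regular k s \<longleftrightarrow>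
     (\<exists>G. finite G \<and> int_seq.span G = int_seq.span (kernel k s))"

(* The set of all bases k for which the letter sequence of w a b is k-regular.  When nonempty, it
   is a single class of multiplicatively dependent integers; the notation "rho (a/b) = k" of the
   literature means that k belongs to it. *)
definition rho :: "nat \<Rightarrow> nat \<Rightarrow> nat set" where
  "rho a b = {k. 2 \<le> k \<and> k_regular k (\<lambda>i. int (w a b !! i))}"

end

theory Submission
  imports Defs
begin

text \<open>
  Write \<open>a = 9 x + 4 y\<close> and \<open>b = 7 x + 3 y\<close> with \<open>x = 4 b - 3 a\<close> and \<open>y = 7 a - 9 b\<close>; the bounds on \<open>a / b\<close>
  say that \<open>x\<close> and \<open>y\<close> are positive.  All distances between consecutive nonzero letters of the word
  are then nonnegative combinations of \<open>x\<close> and \<open>y\<close>, and coefficientwise they form a chain.  An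
  \<open>a / b\<close>-power is a pair of equal windows of length \<open>m (a - b)\<close> at distance \<open>m b\<close>.  If the uniform
  length \<open>k = 24 a - 15 b\<close> divides \<open>m b\<close>, then it divides \<open>m\<close> and the power descends, through the last
  column of the morphism, to one with \<open>m / k\<close> in place of \<open>m\<close>.  Otherwise the windows contain few
  nonzero letters, and comparing the symbolic distances leaves finitely many cases.  Minimality:
  lowering a letter to 0 or 1 completes a power with \<open>m = 1\<close> or \<open>m = 2\<close>, and any other decrease is the
  image under the morphism of a decrease at an earlier position.
\<close>

section \<open>Power-free words and fixed points\<close>

text \<open>The obstacle is that infinitely many exponents have to be treated at once, so no
  comparison of lengths may depend on the ratio of \<open>x\<close> and \<open>y\<close>. This is
  what the chain is for: at the first place where two runs of gaps differ, it is known which of the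
  two next nonzero letters comes first. The end of a common window is thus known symbolically, and
  one evaluation over pairs of indices serves every exponent.

  The condition gcd(b, 24) = 1 enters through k = 24 a - 15 b: together with gcd(a, b) = 1 it makes
  b and k coprime. This gives the step from k dividing m b to k dividing m. It also rules out x = y,
  that is a / b = 13 / 10, the one ratio at which the distance 48 x + 22 y is a multiple of b,
  namely 7 b.

  Three matches of nonzero letters have distances b, 2 b and b, which are genuine periods. Positions
  alone cannot exclude them; there the letters 2 and n + 2 of the morphism are indispensable. For
  the same reason lowering one of these letters to 1 completes a power.\<close>

lemma power_free_iff:
  fixes s :: "'a stream"
  assumes ab: "b < a" "a < 2 * b"
  shows "power_free a b s \<longleftrightarrow> (\<forall>m i. 0 < m \<longrightarrow> (\<exists>j<m * (a - b). s !! (i + j) \<noteq> s !! (i + j + m * b)))"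
proof -
  have ab': "a div b = 1" "a mod b = a - b"
    using ab by (simp_all add: div_nat_eqI mod_if)
  have pow: "frac_pow a b v = v @ take (m * (a - b)) v" if "length v = m * b" for v :: "'a list" and m
    using that ab by (simp add: frac_pow_def ab' mult_ac)
  have power: "is_frac_power a b u \<longleftrightarrow> (\<exists>v m. 0 < m \<and> length v = m * b \<and> u = v @ take (m * (a - b)) v)"
    (is "?l \<longleftrightarrow> ?r") for u :: "'a list"
  proof
    assume ?l
    then obtain v where v: "v \<noteq> []" "b dvd length v" "u = frac_pow a b v"
      by (auto simp: is_frac_power_def)
    then obtain m where m: "length v = m * b" by (metis dvd_def mult.commute)
    then have "0 < m" using v(1) by (cases m) auto
    then show ?r using m v(3) pow[OF m] by blast
  next
    assume ?r
    then obtain v m where v: "0 < m" "length v = m * b" "u = v @ take (m * (a - b)) v" by blast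
    have "0 < length v" using v(1,2) ab by simp
    then have "v \<noteq> []" by auto
    then show ?l using v pow[OF v(2)] unfolding is_frac_power_def by (metis dvd_triv_right)
  qed
  have le: "m * (a - b) \<le> m * b" for m using ab by (intro mult_le_mono2) simp
  show ?thesis
  proof (intro iffI allI impI)
    fix m i :: nat assume pf: "power_free a b s" "0 < m"
    define v where "v = stake (m * b) (sdrop i s)"
    show "\<exists>j<m * (a - b). s !! (i + j) \<noteq> s !! (i + j + m * b)"
    proof (rule ccontr)
      assume *: "\<not> ?thesis"
      have "stake (m * (a - b)) (sdrop (m * b) (sdrop i s)) = take (m * (a - b)) v"
      proof (intro nth_equalityI)
        fix j assume "j < length (stake (m * (a - b)) (sdrop (m * b) (sdrop i s)))"
        then have j: "j < m * (a - b)" by simp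
        then have eq: "s !! (i + j) = s !! (i + j + m * b)" using * by blast
        have "j < m * b" using j le[of m] by (rule less_le_trans)
        then show "stake (m * (a - b)) (sdrop (m * b) (sdrop i s)) ! j = take (m * (a - b)) v ! j"
          using j eq by (simp add: v_def sdrop_snth add_ac)
      qed (use le[of m] in \<open>simp add: v_def\<close>)
      then have "stake (m * b + m * (a - b)) (sdrop i s) = v @ take (m * (a - b)) v"
        unfolding stake_add[symmetric] by (simp add: v_def)
      then have "is_frac_power a b (stake (m * b + m * (a - b)) (sdrop i s))"
        unfolding power using pf(2) by (intro exI[of _ v] exI[of _ m]) (simp add: v_def)
      then show False using pf(1) unfolding power_free_def factor_def by blast
    qed
  next
    assume *: "\<forall>m i. 0 < m \<longrightarrow> (\<exists>j<m * (a - b). s !! (i + j) \<noteq> s !! (i + j + m * b))"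
    show "power_free a b s" unfolding power_free_def factor_def
    proof (intro allI impI notI, elim exE)
      fix u i n assume "is_frac_power a b u" and u: "u = stake n (sdrop i s)"
      then obtain v m where v: "0 < m" "length v = m * b" "u = v @ take (m * (a - b)) v"
        unfolding power by blast
      obtain j where j: "j < m * (a - b)" "s !! (i + j) \<noteq> s !! (i + j + m * b)" using * v(1) by blast
      have n: "n = m * b + m * (a - b)" using arg_cong[OF v(3), of length] v(2) le[of m] by (simp add: u)
      have "j < m * b" using j(1) le[of m] by (rule less_le_trans)
      then have "u ! j = u ! (m * b + j)" using v(2) j(1) unfolding v(3) by (simp add: nth_append)
      then show False using j \<open>j < m * b\<close> by (simp add: u n sdrop_snth add_ac)
    qed
  qed
qed

lemma lex_less_iff: "lex_less s t \<longleftrightarrow> (\<exists>n. (\<forall>i<n. s !! i = t !! i) \<and> s !! n < t !! n)"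
proof -
  have "stake n s = stake n t \<longleftrightarrow> (\<forall>i<n. s !! i = t !! i)" for n
    by (metis length_stake nth_equalityI stake_nth)
  then show ?thesis by (simp add: lex_less_def)
qed

lemma lex_less_asym: "lex_less s t \<Longrightarrow> \<not> lex_less t s"
  unfolding lex_less_iff by (metis linorder_neqE_nat order_less_asym order_less_irrefl)

lemma w_eqI:
  assumes "power_free a b s" "\<And>t. power_free a b t \<Longrightarrow> s = t \<or> lex_less s t"
  shows "w a b = s"
  unfolding w_def using assms lex_less_asym by (intro the_equality) blast+

lemma flat_smap_stake:
  assumes "\<And>c. f c \<noteq> []"
  shows "flat (smap f s) = concat (map f (stake n s)) @- flat (smap f (sdrop n s))"
proof (induction n arbitrary: s)
  case (Suc n)
  have "flat (smap f s) = f (shd s) @- flat (smap f (stl s))"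
    using flat_unfold[of "smap f s"] assms by simp
  then show ?case using Suc[of "stl s"] by simp
qed simp

text \<open>Uniqueness holds because the image of a prefix of length n > 0 has more than n letters:
  no image is empty and that of \<open>c\<close> has at least two letters. Hence two fixed points
  that agree on n letters agree on one more.\<close>

lemma morph_fix_eqI:
  assumes ne: "\<And>c. f c \<noteq> []" and len: "2 \<le> length (f c)"
    and s: "shd s = c" "flat (smap f s) = s"
  shows "morph_fix f c = s"
  unfolding morph_fix_def
proof (rule the_equality)
  fix t assume t: "shd t = c \<and> flat (smap f t) = t"
  have long: "n < length (concat (map f (stake n t)))" if "0 < n" "shd t = c" for n t
  proof -
    have "length xs \<le> length (concat (map f xs))" for xs
    proof (induction xs)
      case (Cons c xs)
      then show ?case using ne[of c] by (cases "f c") auto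
    qed simp
    from this[of "stake (n - 1) (stl t)"] that len show ?thesis by (cases n) auto
  qed
  have "stake n t = stake n s" for n
  proof (induction n)
    case (Suc n)
    show ?case
    proof (cases "n = 0")
      case False
      define l where "l = concat (map f (stake n s))"
      have "flat (smap f s) = l @- flat (smap f (sdrop n s))"
        unfolding l_def by (rule flat_smap_stake[OF ne])
      moreover have "flat (smap f t) = l @- flat (smap f (sdrop n t))"
        unfolding l_def Suc[symmetric] by (rule flat_smap_stake[OF ne])
      moreover have "flat (smap f t) = t" using t by simp
      moreover have "Suc n \<le> length l" using long[of n s] False s(1) by (simp add: l_def)
      then have "stake (Suc n) (l @- u) = take (Suc n) l" for u by (simp add: stake_shift del: stake.simps)
      ultimately have "stake (Suc n) s = take (Suc n) l" "stake (Suc n) t = take (Suc n) l"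
        using s(2) by metis+
      then show ?thesis by simp
    qed (use s t in simp)
  qed simp
  then have "t !! n = s !! n" for n using stake_nth[of n "Suc n"] by (metis lessI)
  then have "snth t = snth s" by (rule ext)
  then show "t = s" by (metis stream_smap_nats)
qed (use s in simp)

lemma concat_uniform_nth:
  assumes "\<And>i. length (g i) = k" "q < Q" "r < k"
  shows "concat (map g [0..<Q]) ! (k * q + r) = g q ! r"
proof -
  have len: "length (concat (map g [m..<n])) = k * (n - m)" for m n
    by (simp add: length_concat comp_def assms(1) sum_list_triv)
  have "[0..<Q] = [0..<q] @ q # [Suc q..<Q]"
    using assms(2) upt_add_eq_append[of 0 q "Q - q"] by (simp add: upt_conv_Cons)
  then have "concat (map g [0..<Q]) ! (k * q + r) = (g q @ concat (map g [Suc q..<Q])) ! r"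
    by (simp add: nth_append len)
  then show ?thesis using assms by (simp add: nth_append)
qed

text \<open>The solution of s = v f(s 0) f(s 1) ... for a \<open>k\<close>-uniform \<open>f\<close>,
  computed letter by letter: past \<open>v\<close>, position n lies in the image of the letter with
  index (n - |v|) div k. The test for \<open>v = []\<close> only makes the recursion total.\<close>

function affine_fix :: "'a list \<Rightarrow> ('a \<Rightarrow> 'a list) \<Rightarrow> nat \<Rightarrow> nat \<Rightarrow> 'a" where
  "affine_fix v f k n = (if v = [] \<or> n < length v then v ! n
     else f (affine_fix v f k ((n - length v) div k)) ! ((n - length v) mod k))"
  by auto
termination
proof (relation "measure (\<lambda>(v, f, k, n). n)")
  fix v :: "'a list" and f :: "'a \<Rightarrow> 'a list" and k n
  assume "\<not> (v = [] \<or> n < length v)"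
  moreover have "(n - length v) div k \<le> n - length v" by simp
  moreover have "0 < length v" using calculation(1) by simp
  ultimately have "(n - length v) div k < n" by linarith
  then show "((v, f, k, (n - length v) div k), v, f, k, n) \<in> measure (\<lambda>(v, f, k, n). n)" by simp
qed simp

declare affine_fix.simps [simp del]

section \<open>Finitely generated submodules\<close>

text \<open>Regularity asks for finitely many generators of the span of the kernel itself, which
  will only be known to lie inside a finitely generated module. As for any noetherian ring, a member
  of \<open>M\<close> whose coefficient at \<open>g\<close> is the least positive one,
  \<open>d\<close>, is added to generators of the part of \<open>M\<close> inside the span of
  \<open>B\<close>; division by \<open>d\<close> moves every other member into that part.\<close>

lemma finitely_generated_submodule:
  assumes "finite B" "int_seq.subspace M" "M \<subseteq> int_seq.span B"
  shows "\<exists>G. finite G \<and> int_seq.span G = M"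
  using assms
proof (induction B arbitrary: M rule: finite_induct)
  case empty
  then have "M = {0}" using int_seq.subspace_0 by auto
  then show ?case by (intro exI[of _ "{}"]) simp
next
  case (insert g B)
  define C where "C = {c. \<exists>m\<in>M. m - seq_scale c g \<in> int_seq.span B}"
  have M: "\<exists>c. c \<in> C \<and> m - seq_scale c g \<in> int_seq.span B" if "m \<in> M" for m
    using insert.prems(2) that unfolding C_def int_seq.span_insert by blast
  note sub = int_seq.subspace_add int_seq.subspace_diff int_seq.subspace_scale
  obtain G where G: "finite G" "int_seq.span G = M \<inter> int_seq.span B"
    using insert.IH[of "M \<inter> int_seq.span B"] insert.prems(1)
    by (auto simp: int_seq.subspace_inter)
  show ?case
  proof (cases "\<exists>c\<in>C. 0 < c")
    case False
    have "c = 0" if c: "c \<in> C" for c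
    proof -
      obtain m where m: "m \<in> M" "m - seq_scale c g \<in> int_seq.span B" using c by (auto simp: C_def)
      have "- m \<in> M" using m(1) insert.prems(1) by (rule int_seq.subspace_neg[rotated])
      moreover have "- m - seq_scale (- c) g = - (m - seq_scale c g)"
        by (simp add: int_seq.scale_minus_left)
      then have "- m - seq_scale (- c) g \<in> int_seq.span B" using int_seq.span_neg[OF m(2)] by (simp only:)
      ultimately have "- c \<in> C" unfolding C_def by blast
      then show ?thesis using c False by (meson neg_0_less_iff_less linorder_neqE)
    qed
    then have "M \<subseteq> int_seq.span B" using M by fastforce
    then show ?thesis using G by (metis inf.absorb1)
  next
    case True
    define d where "d = (LEAST n::nat. 0 < n \<and> int n \<in> C)"
    obtain c where "c \<in> C" "0 < c" using True by blast
    then have "0 < nat c \<and> int (nat c) \<in> C" by simp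
    then have d: "0 < d \<and> int d \<in> C" unfolding d_def by (rule LeastI)
    have d_least: "d \<le> n" if "0 < n" "int n \<in> C" for n unfolding d_def using that by (intro Least_le) simp
    obtain m0 where m0: "m0 \<in> M" "m0 - seq_scale (int d) g \<in> int_seq.span B" using d by (auto simp: C_def)
    have "M \<subseteq> int_seq.span (insert m0 G)"
    proof
      fix m assume m: "m \<in> M"
      then obtain c where c: "m - seq_scale c g \<in> int_seq.span B" using M by blast
      define q where "q = c div int d"
      define m' where "m' = m - seq_scale q m0"
      have "m' \<in> M" unfolding m'_def using m m0(1) insert.prems(1) sub by blast
      have "m' - seq_scale (c mod int d) g = (m - seq_scale c g) - seq_scale q (m0 - seq_scale (int d) g)"
      proof -
        have "seq_scale c g = seq_scale (q * int d + c mod int d) g" by (simp add: q_def)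
        also have "\<dots> = seq_scale q (seq_scale (int d) g) + seq_scale (c mod int d) g"
          by (simp add: int_seq.scale_left_distrib)
        finally show ?thesis by (simp add: m'_def int_seq.scale_right_diff_distrib)
      qed
      then have m': "m' - seq_scale (c mod int d) g \<in> int_seq.span B"
        using c m0(2) by (simp add: int_seq.span_diff int_seq.span_scale)
      then have "c mod int d \<in> C" using \<open>m' \<in> M\<close> by (auto simp: C_def)
      moreover have "0 \<le> c mod int d" "c mod int d < int d" using d by simp_all
      ultimately have "c mod int d = 0"
        using d_least[of "nat (c mod int d)"] by (cases "c mod int d = 0") auto
      then have "m' \<in> int_seq.span G" using m' \<open>m' \<in> M\<close> G(2) by simp
      then show "m \<in> int_seq.span (insert m0 G)" by (auto simp: int_seq.span_insert m'_def)
    qed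
    moreover have "int_seq.span (insert m0 G) \<subseteq> M"
      using m0(1) G(2) int_seq.span_superset[of G] insert.prems(1) by (intro int_seq.span_minimal) auto
    ultimately show ?thesis using G(1) by (intro exI[of _ "insert m0 G"]) auto
  qed
qed

section \<open>Symbolic distances\<close>

text \<open>The exponents in the morphism plus one, as coefficients of \<open>x\<close> and
  \<open>y\<close>, rotated so that its last two blocks come first. The word v ends with two gaps of
  the same length a - b, so the gaps are periodic from the first nonzero letter on, and not only
  after v.\<close>

definition gaps :: "(nat \<times> nat) list" where
  "gaps = [
    (2,1), (2,1), (2,1), (4,2), (5,2), (4,2), (2,1), (3,1), (1,1), (5,2), (4,2), (2,1),
    (3,1), (3,1), (3,2), (3,1), (1,1), (2,1), (3,1), (6,3), (3,1), (2,1), (1,0), (3,2),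
    (4,2), (2,1), (3,1), (6,3), (3,1), (1,1), (2,1), (3,1), (4,2), (2,1), (3,1), (6,3),
    (3,1)]"

text \<open>
  The \<open>i\<close>th nonzero letter has index \<open>i \<ge> 1\<close>, and \<open>gs i\<close> separates it from the next one; \<open>gs 0\<close> is the
  number of letters up to and including the first nonzero one.
\<close>

definition gs :: "nat \<Rightarrow> nat \<times> nat" where
  "gs i = (if i = 0 then (9, 4) else gaps ! ((i - 1) mod 37))"

section \<open>Symbolic lengths and the finite tests on them\<close>

fun ple :: "nat \<times> nat \<Rightarrow> nat \<times> nat \<Rightarrow> bool" where
  "ple (p, q) (p', q') \<longleftrightarrow> p \<le> p' \<and> q \<le> q'"

fun padd :: "nat \<times> nat \<Rightarrow> nat \<times> nat \<Rightarrow> nat \<times> nat" where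
  "padd (p, q) (p', q') = (p + p', q + q')"

text \<open>Here \<open>acc\<close> bounds the distance from the start of the window to the current
  matched pair of nonzero letters. At the first pair of different gaps, the window has to end before
  the nearer of the two next nonzero letters. Incomparable gaps or an exhausted list give
  \<open>None\<close>, which counts as a failed test.\<close>

fun overlap :: "nat \<times> nat \<Rightarrow> (nat \<times> nat) list \<Rightarrow> (nat \<times> nat) list \<Rightarrow> (nat \<times> nat) option" where
  "overlap acc (p # ps) (q # qs) =
     (if p = q then overlap (padd acc p) ps qs
      else if ple p q then Some (padd acc p)
      else if ple q p then Some (padd acc q) else None)"
| "overlap acc _ _ = None"

text \<open>
  In the following tests \<open>(p, q)\<close> stands for the length \<open>p x + q y\<close>.  The first one excludes
  \<open>p x + q y = m b\<close> for all \<open>m\<close>: the numbers \<open>p / 7\<close> and \<open>q / 3\<close> lie between the same two consecutive integers.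
  The second one excludes it under the assumption that \<open>m (a - b) < r x + t y\<close>.
\<close>

fun noshift :: "nat \<times> nat \<Rightarrow> bool" where
  "noshift (p, q) = (let m = p div 7 in 3 * m \<le> q \<and> q \<le> 3 * (m + 1) \<and> (p, q) \<noteq> (7 * m, 3 * m))"

fun far :: "nat \<times> nat \<Rightarrow> nat \<times> nat \<Rightarrow> bool" where
  "far (p, q) (r, t) = (let m = min (p div 7) (q div 3) in r \<le> 2 * m \<and> t \<le> m)"

text \<open>
  \<open>S\<close> bounds the length of equal windows that match the \<open>i\<close>th nonzero letter with the \<open>(i + d)\<close>th, at
  distance \<open>D\<close>.  The distance \<open>48 x + 22 y\<close> is a multiple of \<open>b\<close> only if \<open>x = y\<close>, and in the last three
  cases the two letters differ.
\<close>

definition match_test :: "nat \<Rightarrow> nat \<Rightarrow> nat \<times> nat \<Rightarrow> (nat \<times> nat) option \<Rightarrow> bool" where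
  "match_test i d D S = (case S of None \<Rightarrow> False | Some S \<Rightarrow> ple S (30, 15) \<and>
     (noshift D \<or> far D S \<or> D = (48, 22) \<or> (i, d) \<in> {(32, 2), (34, 4), (37, 3)}))"

text \<open>
  Windows of zeros inside gaps of lengths \<open>p\<close> and \<open>q\<close>, where \<open>E\<close> is the distance from the end of the
  first gap to the beginning of the second.
\<close>

definition zero_test :: "nat \<Rightarrow> nat \<times> nat \<Rightarrow> nat \<times> nat \<Rightarrow> nat \<times> nat \<Rightarrow> bool" where
  "zero_test m E p q \<longleftrightarrow> ple p (2 * m, m) \<or> ple q (2 * m, m) \<or> ple (5 * m, 2 * m) E
     \<or> ple (padd E (padd p q)) (9 * m, 4 * m)"

text \<open>The \<open>i\<close>th nonzero letter has the gap \<open>p\<close> before it and the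
  gaps \<open>ps\<close> after it; \<open>q\<close> is the gap before the \<open>(i + d)\<close>th,
  and \<open>E\<close> the distance from the \<open>i\<close>th to the beginning of
  \<open>q\<close>. A window cannot reach further back than the shorter of \<open>p\<close> and
  \<open>q\<close>, whence the initial bound of \<open>overlap\<close>. At \<open>d = 37\<close> the
  gaps repeat.\<close>

fun scan :: "nat \<Rightarrow> nat \<times> nat \<Rightarrow> (nat \<times> nat) list \<Rightarrow> nat \<Rightarrow> nat \<times> nat \<Rightarrow> (nat \<times> nat) list \<Rightarrow> bool" where
  "scan i p ps d E (q # qs) = (if d = 37 then True else
     zero_test 1 E p q \<and> zero_test 2 E p q \<and>
     match_test i d (padd E q) (overlap (if ple p q then p else q) ps qs) \<and>
     scan i p ps (d + 1) (padd E q) qs)"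
| "scan i p ps d E [] = False"

text \<open>The row 1 has the exceptional first gap before it; the rows 2 to 38 form a full
  period.\<close>

fun rows :: "nat \<Rightarrow> (nat \<times> nat) list \<Rightarrow> bool" where
  "rows i (p # ps) = (if i = 39 then True else scan i p ps 1 (0, 0) ps \<and> rows (i + 1) ps)"
| "rows i [] = False"

text \<open>Three periods are enough: i + d is at most 38 + 36, so a whole period remains after the
  second letter for the comparison in \<open>overlap\<close>.\<close>

lemma rows_gaps: "rows 1 ((9, 4) # gaps @ gaps @ gaps)"
  by code_simp

section \<open>Soundness of the tests\<close>

lemma mod_eq_nat_decomp: "i mod n = c \<Longrightarrow> \<exists>d. i = c + n * d" for i n c :: nat
  using mult_div_mod_eq[of n i] by (intro exI[of _ "i div n"]) simp

lemma gaps_length: "length gaps = 37"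
  by (simp add: gaps_def)

lemma gs_0 [simp]: "gs 0 = (9, 4)"
  by (simp add: gs_def)

lemma gs_period: "0 < i \<Longrightarrow> gs (i + 37) = gs i"
  by (cases i) (simp_all add: gs_def)

lemma gs_period_mult: "0 < i \<Longrightarrow> gs (i + 37 * n) = gs i"
proof (induction n)
  case (Suc n)
  have "gs (i + 37 * n + 37) = gs (i + 37 * n)" using Suc.prems by (intro gs_period) simp
  moreover have "i + 37 * Suc n = i + 37 * n + 37" by simp
  ultimately show ?case using Suc by (simp only:)
qed simp

lemma map_gs: "map gs [0..<112] = (9, 4) # gaps @ gaps @ gaps"
proof -
  have "map gs [0..<112] = (9,4) # map (\<lambda>i. gs (Suc i)) [0..<111]"
    by (subst upt_conv_Cons) (auto intro!: nth_equalityI simp del: upt_Suc)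
  also have "map (\<lambda>i. gs (Suc i)) [0..<111] = gaps @ gaps @ gaps"
  proof (rule nth_equalityI)
    fix i assume "i < length (map (\<lambda>i. gs (Suc i)) [0..<111])"
    then consider "i < 37" | t where "t < 37" "i = 37 + t" | t where "t < 37" "i = 37 + (37 + t)"
      using that(2)[of "i - 37"] that(3)[of "i - 74"]
      by (cases "i < 37"; cases "i < 74") (simp_all del: upt_Suc)
    moreover have "(74 + t) mod 37 = t" if "t < 37" for t :: nat using that mod_mult_self2[of t 37 2] by (simp add: add.commute)
    ultimately show "map (\<lambda>i. gs (Suc i)) [0..<111] ! i = (gaps @ gaps @ gaps) ! i"
      by cases (simp_all add: gs_def gaps_length nth_append del: upt_Suc)
  qed (simp add: gaps_length)
  finally show ?thesis .
qed

lemma gs_in: "0 < i \<Longrightarrow> gs i \<in> set gaps"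
  by (simp add: gs_def gaps_length)

lemma ple_chain: "p \<in> set gaps \<Longrightarrow> ple p (6, 3) \<and> ple (1, 0) p"
  by (auto simp: gaps_def)

lemma scan_sound:
  assumes "scan i p ps d E (map gs [l..<n])" "l \<le> l'" "l' - l + d < 37" "d \<le> 37"
  shows "\<exists>E'. E' = (fst E + (\<Sum>t=l..<l'. fst (gs t)), snd E + (\<Sum>t=l..<l'. snd (gs t))) \<and> l' < n \<and>
     zero_test 1 E' p (gs l') \<and> zero_test 2 E' p (gs l') \<and>
     match_test i (l' - l + d) (padd E' (gs l'))
       (overlap (if ple p (gs l') then p else gs l') ps (map gs [Suc l'..<n]))"
  using assms
proof (induction "l' - l" arbitrary: l d E)
  case 0
  then have "l' = l" by simp
  moreover have "l < n" using 0 by (cases "l < n") auto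
  ultimately show ?case using 0 by (cases "ple p (gs l)") (simp_all add: upt_conv_Cons del: upt_Suc)
next
  case (Suc e)
  then have "l < l'" by simp
  have "l < n" using Suc.prems by (cases "l < n") auto
  then have "scan i p ps (d + 1) (padd E (gs l)) (map gs [Suc l..<n])"
    using Suc.prems Suc.hyps(2) by (simp add: upt_conv_Cons del: upt_Suc)
  from Suc.hyps(1)[OF _ this] Suc.hyps(2) Suc.prems \<open>l < l'\<close>
  have "\<exists>E'. E' = (fst (padd E (gs l)) + (\<Sum>t=Suc l..<l'. fst (gs t)), snd (padd E (gs l)) + (\<Sum>t=Suc l..<l'. snd (gs t))) \<and> l' < n \<and>
     zero_test 1 E' p (gs l') \<and> zero_test 2 E' p (gs l') \<and>
     match_test i (l' - l + d) (padd E' (gs l'))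
       (overlap (if ple p (gs l') then p else gs l') ps (map gs [Suc l'..<n]))"
    by (simp add: Suc_diff_Suc)
  moreover have "fst (padd E (gs l)) + (\<Sum>t=Suc l..<l'. fst (gs t)) = fst E + (\<Sum>t=l..<l'. fst (gs t))"
     "snd (padd E (gs l)) + (\<Sum>t=Suc l..<l'. snd (gs t)) = snd E + (\<Sum>t=l..<l'. snd (gs t))"
    using \<open>l < l'\<close> by (cases E; cases "gs l"; simp add: sum.atLeast_Suc_lessThan)+
  ultimately show ?case by simp
qed

lemma rows_sound:
  assumes "rows i (map gs [l..<n])" "i \<le> i'" "i' < 39"
  shows "l + (i' - i) < n \<and> scan i' (gs (l + (i' - i))) (map gs [Suc (l + (i' - i))..<n]) 1 (0, 0)
    (map gs [Suc (l + (i' - i))..<n])"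
  using assms
proof (induction "i' - i" arbitrary: i l)
  case 0
  then have "i' = i" by simp
  with 0 show ?case by (cases "l < n") (auto simp: upt_conv_Cons simp del: upt_Suc)
next
  case (Suc e)
  have "l < n" using Suc.prems by (cases "l < n") auto
  then have "rows (i + 1) (map gs [Suc l..<n])"
    using Suc.prems by (auto simp: upt_conv_Cons simp del: upt_Suc split: if_splits)
  from Suc.hyps(1)[OF _ this] Suc.hyps(2) Suc.prems
  have "Suc l + (i' - (i + 1)) < n \<and> scan i' (gs (Suc l + (i' - (i + 1))))
    (map gs [Suc (Suc l + (i' - (i + 1)))..<n]) 1 (0, 0) (map gs [Suc (Suc l + (i' - (i + 1)))..<n])"
    by simp
  moreover have "Suc l + (i' - (i + 1)) = l + (i' - i)" using Suc.hyps(2) by simp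
  ultimately show ?case by (simp only:)
qed

definition symgap :: "nat \<Rightarrow> nat \<Rightarrow> nat \<times> nat" where
  "symgap i j = (\<Sum>l=i..<j. fst (gs l), \<Sum>l=i..<j. snd (gs l))"

lemma gap_tests:
  assumes "0 < i" "i < 39" "0 < d" "d < 37"
  shows "zero_test 1 (symgap i (i + d - 1)) (gs (i - 1)) (gs (i + d - 1))"
    "zero_test 2 (symgap i (i + d - 1)) (gs (i - 1)) (gs (i + d - 1))"
    "match_test i d (symgap i (i + d))
       (overlap (if ple (gs (i - 1)) (gs (i + d - 1)) then gs (i - 1) else gs (i + d - 1))
          (map gs [i..<112]) (map gs [i + d..<112]))"
proof -
  have "scan i (gs (i - 1)) (map gs [i..<112]) 1 (0, 0) (map gs [i..<112])"
    using rows_sound[of 1 0 112 i] rows_gaps assms by (simp add: map_gs del: upt_Suc)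
  from scan_sound[OF this, of "i + d - 1"] assms
  have 1: "zero_test 1 (symgap i (i + d - 1)) (gs (i - 1)) (gs (i + d - 1)) \<and>
    zero_test 2 (symgap i (i + d - 1)) (gs (i - 1)) (gs (i + d - 1)) \<and>
    match_test i d (padd (symgap i (i + d - 1)) (gs (i + d - 1)))
       (overlap (if ple (gs (i - 1)) (gs (i + d - 1)) then gs (i - 1) else gs (i + d - 1))
          (map gs [i..<112]) (map gs [i + d..<112]))"
    by (simp add: symgap_def del: upt_Suc)
  have "padd (symgap i (i + d - 1)) (gs (i + d - 1)) = symgap i (i + d)"
  proof -
    obtain e where "d = Suc e" using assms by (cases d) auto
    then show ?thesis by (cases "gs (i + e)") (simp add: symgap_def)
  qed
  with 1 show "zero_test 1 (symgap i (i + d - 1)) (gs (i - 1)) (gs (i + d - 1))"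
    "zero_test 2 (symgap i (i + d - 1)) (gs (i - 1)) (gs (i + d - 1))"
    "match_test i d (symgap i (i + d))
       (overlap (if ple (gs (i - 1)) (gs (i + d - 1)) then gs (i - 1) else gs (i + d - 1))
          (map gs [i..<112]) (map gs [i + d..<112]))"
    by auto
qed

text \<open>The coefficients of the positions of the nonzero letters 1 to 43, after a virtual
  position 0, written out so that the entries below are checked by lookup.\<close>

definition mark_pos :: "(nat \<times> nat) list" where
  "mark_pos = [
    (0,0), (9,4), (11,5), (13,6), (15,7), (19,9), (24,11), (28,13), (30,14), (33,15),
    (34,16), (39,18), (43,20), (45,21), (48,22), (51,23), (54,25), (57,26), (58,27),
    (60,28), (63,29), (69,32), (72,33), (74,34), (75,34), (78,36), (82,38), (84,39),
    (87,40), (93,43), (96,44), (97,45), (99,46), (102,47), (106,49), (108,50), (111,51),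
    (117,54), (120,55), (122,56), (124,57), (126,58), (130,60), (135,62)]"

text \<open>
  An entry \<open>(i, m, j, u)\<close> says that decreasing the \<open>i\<close>th nonzero letter creates a power with period
  \<open>m b\<close>: moved back by the period, this letter falls behind the \<open>j\<close>th nonzero letter, on a zero
  or on the next nonzero letter according to \<open>witness_zero\<close> below, and the \<open>u\<close>
  nonzero letters in the window before it match the \<open>u\<close> ones ending with the \<open>j\<close>th.
\<close>

definition witnesses :: "(nat \<times> nat \<times> nat \<times> nat) list" where
  "witnesses = [
    (1,1,0,0), (2,1,0,0), (3,1,0,0), (4,1,0,0), (5,2,0,0), (6,1,4,0), (7,1,5,0),
    (8,1,5,0), (9,1,6,0), (10,2,5,1), (11,1,8,0), (12,1,10,0), (13,1,10,0), (14,1,11,0),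
    (15,2,10,1), (16,1,13,0), (17,1,14,0), (18,2,12,1), (19,1,15,0), (20,1,16,0),
    (21,1,19,0), (22,1,20,0), (23,1,20,0), (24,2,19,2), (25,1,21,0), (26,2,20,0),
    (27,1,24,0), (28,1,25,0), (29,1,27,0), (30,1,28,0), (31,2,26,1), (32,1,28,0),
    (33,1,29,0), (34,2,28,0), (35,1,32,0), (36,1,33,0), (37,1,35,0), (38,1,36,0),
    (39,1,36,0), (40,2,35,1), (41,1,37,0), (42,2,36,0)]"

fun psums :: "nat \<times> nat \<Rightarrow> (nat \<times> nat) list \<Rightarrow> (nat \<times> nat) list" where
  "psums p (q # qs) = p # psums (padd p q) qs"
| "psums p [] = [p]"

lemma mark_pos_psums: "mark_pos = psums (0, 0) ((9, 4) # gaps @ take 5 gaps)"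
  by (simp add: mark_pos_def gaps_def)

text \<open>The residues 3 and 34 are avoided so that all matched letters are 1. The last two
  conditions put the next nonzero letter further back, on either side, in front of the window, so
  that no unmatched one remains inside. Entries with \<open>i\<close> at least 6 are reused in all
  later periods and therefore must not involve the virtual position 0, which does not recur.\<close>

definition witness_ok :: "nat \<times> nat \<times> nat \<times> nat \<Rightarrow> bool" where
  "witness_ok = (\<lambda>(i, m, j, u). let D = (7 * m, 3 * m); L = (2 * m, m) in
     0 < m \<and> u < i \<and> u \<le> j \<and> j < i \<and> (i < 6 \<or> u < j \<and> u + 1 < i) \<and>
     ple (padd (mark_pos ! j) D) (mark_pos ! i) \<and> padd (mark_pos ! j) D \<noteq> mark_pos ! i \<and>
     ple (mark_pos ! i) (padd (mark_pos ! Suc j) D) \<and>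
     list_all (\<lambda>v. padd (mark_pos ! (j - v)) D = mark_pos ! (i - 1 - v) \<and>
       (j - v) mod 37 \<noteq> 3 \<and> (j - v) mod 37 \<noteq> 34 \<and>
       (i - 1 - v) mod 37 \<noteq> 3 \<and> (i - 1 - v) mod 37 \<noteq> 34) [0..<u] \<and>
     ple (padd (mark_pos ! (i - 1 - u)) L) (mark_pos ! i) \<and>
     ple (padd (padd (mark_pos ! (j - u)) D) L) (mark_pos ! i))"

definition witness_zero :: "nat \<times> nat \<times> nat \<times> nat \<Rightarrow> bool" where
  "witness_zero = (\<lambda>(i, m, j, u). padd (mark_pos ! Suc j) (7 * m, 3 * m) \<noteq> mark_pos ! i)"

lemma witnesses_ok:
  "map fst witnesses = [1..<43] \<and>
   list_all (\<lambda>w. witness_ok w \<and> witness_zero w) witnesses \<and>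
   list_all (\<lambda>w. witness_ok w \<and> \<not> witness_zero w) [(34, 1, 31, 0), (40, 1, 36, 0)]"
  by code_simp

section \<open>Windows of equal letters\<close>

lemma symgap_1_38: "symgap 1 38 = (111, 51)"
  by code_simp

lemma ple_trans: "ple p q \<Longrightarrow> ple q r \<Longrightarrow> ple p r"
  by (cases p; cases q; cases r) auto

lemma gs_bounds: "ple (1, 0) (gs i)" "ple (gs i) (9, 4)" "0 < i \<Longrightarrow> ple (gs i) (6, 3)"
proof -
  show *: "0 < i \<Longrightarrow> ple (gs i) (6, 3)" using ple_chain gs_in by blast
  show "ple (1, 0) (gs i)" using ple_chain gs_in by (cases "i = 0") auto
  show "ple (gs i) (9, 4)" using ple_trans[OF *, of "(9, 4)"] by (cases "i = 0") auto
qed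

lemma symgap_shift:
  assumes "0 < i" shows "symgap (i + 37 * c) (j + 37 * c) = symgap i j"
  using assms unfolding symgap_def
  by (simp add: sum.shift_bounds_nat_ivl gs_period_mult)

lemma map_gs_shift: "0 < p \<Longrightarrow> map gs [p + 37 * c..<p + 37 * c + l] = map gs [p..<p + l]"
proof (rule nth_equalityI)
  fix t assume "0 < p" "t < length (map gs [p + 37 * c..<p + 37 * c + l])"
  then show "map gs [p + 37 * c..<p + 37 * c + l] ! t = map gs [p..<p + l] ! t"
    using gs_period_mult[of "p + t" c] by (simp add: add_ac del: upt_Suc)
qed simp

locale exponent =
  fixes x y :: nat
  assumes x: "0 < x" and y: "0 < y" and coprime_period: "coprime (7 * x + 3 * y) (111 * x + 51 * y)"
begin

lemma xy: "x \<noteq> y"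
proof
  assume "x = y"
  then have "coprime (2 * (5 * x)) (2 * (81 * x))" using coprime_period by simp
  then have "is_unit (2 :: nat)" by (rule coprime_common_divisor) simp_all
  then show False by simp
qed

section \<open>Positions of the nonzero letters\<close>

definition val :: "nat \<times> nat \<Rightarrow> nat" where
  "val p = fst p * x + snd p * y"

text \<open>
  Positions are counted from 1 here, so \<open>z n\<close> below is the letter at position \<open>n + 1\<close> and \<open>R 0 = 0\<close>
  is a virtual position in front of the word.
\<close>

definition R :: "nat \<Rightarrow> nat" where
  "R i = (\<Sum>l<i. val (gs l))"

definition mark :: "nat \<Rightarrow> bool" where
  "mark N \<longleftrightarrow> (\<exists>i>0. N = R i)"

lemma val_padd [simp]: "val (padd p q) = val p + val q"
  by (cases p; cases q) (simp add: val_def algebra_simps)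

lemma val_mono: "ple p q \<Longrightarrow> val p \<le> val q"
  by (cases p; cases q) (auto simp: val_def intro: add_mono mult_le_mono1)

lemma val_strict_mono: "ple p q \<Longrightarrow> p \<noteq> q \<Longrightarrow> val p < val q"
  using x y by (cases p; cases q)
    (auto simp: val_def order.order_iff_strict intro: add_strict_mono)

lemma val_gs_pos [simp]: "0 < val (gs i)"
  using less_le_trans[OF _ val_mono[OF gs_bounds(1)[of i]], of 0] x by (simp add: val_def)

lemma R_0 [simp]: "R 0 = 0"
  by (simp add: R_def)

lemma R_Suc: "R (Suc i) = R i + val (gs i)"
  by (simp add: R_def)

lemma R_strict_mono: "strict_mono R"
  by (simp add: strict_mono_Suc_iff R_Suc)

lemma R_less [simp]: "R i < R j \<longleftrightarrow> i < j"
  by (rule strict_mono_less[OF R_strict_mono])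

lemma R_le [simp]: "R i \<le> R j \<longleftrightarrow> i \<le> j"
  by (rule strict_mono_less_eq[OF R_strict_mono])

lemma R_eq [simp]: "R i = R j \<longleftrightarrow> i = j"
  by (rule strict_mono_eq[OF R_strict_mono])

lemma R_ge: "i \<le> R i"
  by (rule strict_mono_imp_increasing[OF R_strict_mono])

lemma R_pred: "0 < i \<Longrightarrow> R i = R (i - 1) + val (gs (i - 1))"
  using R_Suc[of "i - 1"] by simp

lemma mark_R [simp]: "0 < i \<Longrightarrow> mark (R i)"
  by (auto simp: mark_def)

lemma R_symgap: "i \<le> j \<Longrightarrow> R j = R i + val (symgap i j)"
proof (induction j rule: dec_induct)
  case base then show ?case by (simp add: symgap_def val_def)
next
  case (step n) then show ?case by (simp add: symgap_def val_def R_Suc algebra_simps)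
qed

lemma R_period: "0 < i \<Longrightarrow> R (i + 37) = R i + (111 * x + 51 * y)"
proof (induction i)
  case (Suc i)
  show ?case
  proof (cases "i = 0")
    case True
    with R_symgap[of 1 38] show ?thesis unfolding symgap_1_38 by (simp add: val_def)
  next
    case False
    have "R (Suc i + 37) = R (i + 37) + val (gs (i + 37))" using R_Suc[of "i + 37"] by simp
    then show ?thesis using Suc.IH False by (simp add: R_Suc[of i] gs_period)
  qed
qed simp

lemma R_period_mult: "0 < i \<Longrightarrow> R (i + 37 * c) = R i + c * (111 * x + 51 * y)"
proof (induction c)
  case (Suc c)
  have "R (i + 37 * c + 37) = R (i + 37 * c) + (111 * x + 51 * y)"
    by (rule R_period) (use Suc.prems in simp)
  moreover have "i + 37 * Suc c = i + 37 * c + 37" by simp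
  ultimately show ?case using Suc by (simp only: mult_Suc)
qed simp

lemma mark_between: "mark N \<Longrightarrow> R i < N \<Longrightarrow> R (Suc i) \<le> N"
  by (auto simp: mark_def Suc_le_eq)

lemma overlap_mono: "overlap acc ps qs = Some S \<Longrightarrow> val acc \<le> val S"
proof (induction acc ps qs rule: overlap.induct)
  case (1 acc p ps q qs)
  then show ?case by (cases "p = q"; cases "ple p q"; cases "ple q p") auto
qed auto

context
  fixes s L D :: nat
  assumes agree: "\<And>N. s \<le> N \<Longrightarrow> N < s + L \<Longrightarrow> mark N \<longleftrightarrow> mark (N + D)"
begin

text \<open>Whichever of the two next marks comes first inside its window has a partner in the other
  window, and that partner can only be the other next mark.\<close>

lemma agree_next:
  assumes "0 < p" "s \<le> R p" "R q = R p + D" "R (Suc p) < s + L \<or> R (Suc q) < s + L + D"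
  shows "R (Suc q) = R (Suc p) + D"
proof -
  have pq: "R p < R (Suc p)" "R q < R (Suc q)" by simp_all
  have le: "R (Suc q) \<le> R (Suc p) + D" if "R (Suc p) < s + L"
  proof -
    have "mark (R (Suc p) + D)" using agree[of "R (Suc p)"] that assms pq by simp
    then show ?thesis using mark_between assms(3) pq by simp
  qed
  have ge: "R (Suc p) + D \<le> R (Suc q)" if "R (Suc q) < s + L + D"
  proof -
    have "mark (R (Suc q) - D)" using agree[of "R (Suc q) - D"] that assms pq by simp
    then have "R (Suc p) \<le> R (Suc q) - D" using mark_between[of _ p] assms(3) pq by simp
    then show ?thesis using assms(3) pq by simp
  qed
  show ?thesis using le ge assms(4) by linarith
qed

lemma overlap_bound:
  assumes "overlap acc (map gs [p..<p + l]) (map gs [q..<q + l']) = Some S"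
    and "0 < p" "s \<le> R p" "R p < s + L" "R q = R p + D" "R p < s + val acc"
  shows "L < val S"
  using assms
proof (induction l arbitrary: p q l' acc)
  case (Suc l)
  obtain l1 where l': "l' = Suc l1" using Suc.prems(1) by (cases l') auto
  let ?P = "map gs [Suc p..<Suc p + l]" and ?Q = "map gs [Suc q..<Suc q + l1]"
  have ov: "overlap acc (gs p # ?P) (gs q # ?Q) = Some S"
    using Suc.prems(1) unfolding l' by (simp add: upt_conv_Cons del: upt_Suc)
  show ?case
  proof (cases "gs p = gs q")
    case True
    then have ov': "overlap (padd acc (gs p)) ?P ?Q = Some S" using ov by simp
    show ?thesis
    proof (cases "R (Suc p) < s + L")
      case True
      then have "R (Suc q) = R (Suc p) + D" using agree_next Suc.prems by blast
      with Suc.IH[OF ov'] True Suc.prems show ?thesis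
        by (simp add: R_Suc[of p])
    next
      case False
      then show ?thesis using overlap_mono[OF ov'] Suc.prems by (simp add: R_Suc[of p])
    qed
  next
    case False
    have "val (gs p) \<noteq> val (gs q)"
      using ov False val_strict_mono[of "gs p" "gs q"] val_strict_mono[of "gs q" "gs p"]
      by (auto split: if_splits)
    then have "\<not> (R (Suc p) < s + L \<or> R (Suc q) < s + L + D)"
      using agree_next[of p q] Suc.prems by (auto simp: R_Suc)
    then show ?thesis using ov False Suc.prems by (auto simp: R_Suc split: if_splits)
  qed
qed simp

end

lemma no_shift:
  assumes "noshift (p, q)" shows "val (p, q) \<noteq> m * (7 * x + 3 * y)"
proof
  assume *: "val (p, q) = m * (7 * x + 3 * y)"
  define c where "c = p div 7"
  have c: "7 * c \<le> p" "p < 7 * Suc c" "3 * c \<le> q" "q \<le> 3 * Suc c" "(p, q) \<noteq> (7 * c, 3 * c)"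
    using assms by (auto simp: c_def Let_def dividend_less_times_div)
  have *: "p * x + q * y = (7 * m) * x + (3 * m) * y" using * by (simp add: val_def algebra_simps)
  show False
  proof (cases "m \<le> c")
    case True
    have "val (7 * m, 3 * m) < val (p, q)"
      using True c by (intro val_strict_mono) auto
    with * show False by (simp add: val_def)
  next
    case False
    have "val (p, q) < val (7 * m, 3 * m)"
      using False c by (intro val_strict_mono) auto
    with * show False by (simp add: val_def)
  qed
qed

text \<open>A distance of at least c b forces m to be at least c, so the window already has length
  at least c (a - b), which dominates \<open>S\<close>.\<close>

lemma no_far:
  assumes "far (p, q) S" "m * (2 * x + y) < val S" shows "val (p, q) \<noteq> m * (7 * x + 3 * y)"
proof
  assume *: "val (p, q) = m * (7 * x + 3 * y)"
  obtain r t where S: "S = (r, t)" by fastforce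
  define c where "c = min (p div 7) (q div 3)"
  have c: "7 * c \<le> p" "3 * c \<le> q" "r \<le> 2 * c" "t \<le> c"
    using assms by (auto simp: S c_def Let_def)
  have "val (7 * c, 3 * c) \<le> val (p, q)" using c by (intro val_mono) simp
  then have "c * (7 * x + 3 * y) \<le> m * (7 * x + 3 * y)" using * by (simp add: val_def algebra_simps)
  then have "c \<le> m" using x by (simp only: mult_le_cancel2)
  then have "c * (2 * x + y) \<le> m * (2 * x + y)" by (rule mult_le_mono1)
  moreover have "val (r, t) \<le> val (2 * c, c)" using c by (intro val_mono) simp
  ultimately show False using assms(2) by (simp add: val_def S algebra_simps)
qed

lemma no_48_22: "val (48, 22) \<noteq> m * (7 * x + 3 * y)"
proof
  assume *: "val (48, 22) = m * (7 * x + 3 * y)"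
  consider "m \<le> 6" | "m = 7" | "8 \<le> m" by linarith
  then show False
  proof cases
    case 1
    then have "m * (7 * x + 3 * y) \<le> 6 * (7 * x + 3 * y)" by (rule mult_le_mono1)
    with * x show False by (simp add: val_def)
  next
    case 2 with * xy show False by (simp add: val_def)
  next
    case 3
    then have "8 * (7 * x + 3 * y) \<le> m * (7 * x + 3 * y)" by (rule mult_le_mono1)
    with * x show False by (simp add: val_def)
  qed
qed

text \<open>Only the positions of nonzero letters are compared here. With \<open>i\<close> and
  \<open>j\<close> the first marks from the starts of the two windows on, either both are in their
  windows and are matched, or both windows consist of zeros. The second case is impossible; the
  first leaves the three pairs whose letters have to be compared.\<close>

theorem agreeing_windows:
  assumes agree: "\<And>N. s \<le> N \<Longrightarrow> N < s + m * (2 * x + y) \<Longrightarrow> mark N \<longleftrightarrow> mark (N + m * (7 * x + 3 * y))"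
    and "0 < s" "0 < m" and ndvd: "\<not> (111 * x + 51 * y) dvd m * (7 * x + 3 * y)"
  obtains i j where "0 < i" "s \<le> R i" "R i < s + m * (2 * x + y)" "R j = R i + m * (7 * x + 3 * y)"
    "(i mod 37, j mod 37) \<in> {(32, 34), (34, 1), (0, 3)}"
proof -
  define L where "L = m * (2 * x + y)"
  define D where "D = m * (7 * x + 3 * y)"
  define k where "k = 111 * x + 51 * y"
  note agree = agree[folded L_def D_def]
  have pos: "0 < L" "0 < D" using x \<open>0 < m\<close> by (simp_all add: L_def D_def)
  define i where "i = (LEAST i. s \<le> R i)"
  define j where "j = (LEAST j. s + D \<le> R j)"
  have i: "s \<le> R i" unfolding i_def by (rule LeastI[of _ s]) (rule R_ge)
  have j: "s + D \<le> R j" unfolding j_def by (rule LeastI[of _ "s + D"]) (rule R_ge)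
  have i0: "0 < i" using i \<open>0 < s\<close> by (cases i) auto
  have j0: "0 < j" using j \<open>0 < s\<close> by (cases j) auto
  have i_least: "i \<le> i'" if "s \<le> R i'" for i' unfolding i_def using that by (rule Least_le)
  have j_least: "j \<le> j'" if "s + D \<le> R j'" for j' unfolding j_def using that by (rule Least_le)
  have i1: "R (i - 1) < s" using i_least[of "i - 1"] i0 by (cases "s \<le> R (i - 1)") auto
  have j1: "R (j - 1) < s + D" using j_least[of "j - 1"] j0 by (cases "s + D \<le> R (j - 1)") auto
  have Ri: "R i = R (i - 1) + val (gs (i - 1))" by (rule R_pred[OF i0])
  have Rj: "R j = R (j - 1) + val (gs (j - 1))" by (rule R_pred[OF j0])
  have ij: "i \<le> j" using i_least[of j] j by simp
  \<comment> \<open>Only the mark 1 is preceded by the exceptional first gap.\<close>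
  define i' where "i' = (if i = 1 then 1 else (i - 2) mod 37 + 2)"
  define c where "c = (if i = 1 then 0 else (i - 2) div 37)"
  have ic: "i = i' + 37 * c"
  proof (cases "i = 1")
    case False
    then have "i = 2 + (i - 2)" using i0 by simp
    also have "\<dots> = 2 + (37 * ((i - 2) div 37) + (i - 2) mod 37)" by (simp only: mult_div_mod_eq)
    finally show ?thesis using False by (simp add: i'_def c_def)
  qed (simp add: i'_def c_def)
  have i'_bounds: "0 < i'" "i' < 39" using mod_less_divisor[of 37 "i - 2"] by (simp_all add: i'_def)
  have gs_i: "gs (i' - 1) = gs (i - 1)"
  proof (cases "i = 1")
    case False
    then have "2 \<le> i'" by (simp add: i'_def)
    then have "gs (i' - 1 + 37 * c) = gs (i' - 1)" "i - 1 = i' - 1 + 37 * c"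
      using gs_period_mult[of "i' - 1" c] ic by simp_all
    then show ?thesis by (simp only:)
  qed (simp add: i'_def)
  show ?thesis
  proof (cases "R i < s + L")
    case True
    have "mark (R i + D)" using agree[of "R i"] i True i0 by simp
    then obtain j' where j': "R i + D = R j'" by (auto simp: mark_def)
    then have "R j \<le> R i + D" using j_least[of j'] i by simp
    moreover have "mark (R j - D)" using agree[of "R j - D"] calculation j j0 True by simp
    then obtain i'' where i'': "R j - D = R i''" by (auto simp: mark_def)
    then have "R i \<le> R j - D" using i_least[of i''] j by simp
    ultimately have RD: "R j = R i + D" using j by linarith
    have "i < j" using RD pos R_less[of i j] by linarith
    define d where "d = (j - i) mod 37"
    define e where "e = (j - i) div 37"
    have je: "j = i + d + 37 * e" using \<open>i < j\<close> by (simp add: d_def e_def)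
    have "d \<noteq> 0"
    proof
      assume "d = 0"
      then have "D = e * k" using R_period_mult[OF i0, of e] RD je by (simp add: k_def)
      with ndvd show False by (simp add: D_def k_def)
    qed
    then have d: "0 < d" "d < 37" by (simp_all add: d_def)
    have gs_j: "gs (i' + d - 1) = gs (j - 1)"
      using gs_period_mult[of "i' + d - 1" "c + e"] d i'_bounds by (simp add: je ic algebra_simps)
    define acc where "acc = (if ple (gs (i - 1)) (gs (j - 1)) then gs (i - 1) else gs (j - 1))"
    have acc: "R i < s + val acc" using i1 j1 Ri Rj RD by (simp add: acc_def)
    have mt: "match_test i' d (symgap i' (i' + d))
       (overlap acc (map gs [i'..<112]) (map gs [i' + d..<112]))"
      using gap_tests(3)[OF i'_bounds d] unfolding gs_i gs_j acc_def .
    then obtain S where S: "overlap acc (map gs [i'..<112]) (map gs [i' + d..<112]) = Some S"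
      and S1: "ple S (30, 15)"
      and S2: "noshift (symgap i' (i' + d)) \<or> far (symgap i' (i' + d)) S \<or>
        symgap i' (i' + d) = (48, 22) \<or> (i', d) \<in> {(32, 2), (34, 4), (37, 3)}"
      unfolding match_test_def by (auto split: option.splits)
    have "map gs [i'..<112] = map gs [i..<i + (112 - i')]"
      using map_gs_shift[OF i'_bounds(1), of c "112 - i'"] i'_bounds by (simp add: ic del: upt_Suc)
    moreover have "map gs [i' + d..<112] = map gs [j..<j + (112 - (i' + d))]"
      using map_gs_shift[of "i' + d" "c + e" "112 - (i' + d)"] i'_bounds d
      by (simp add: ic je algebra_simps del: upt_Suc)
    ultimately have "overlap acc (map gs [i..<i + (112 - i')]) (map gs [j..<j + (112 - (i' + d))]) = Some S"
      using S by simp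
    from overlap_bound[OF agree this i0 i True RD acc] have LS: "L < val S" by blast
    also have "val S \<le> val (30, 15)" by (rule val_mono[OF S1])
    \<comment> \<open>The bound (30, 15) is 15 (a - b). It gives a distance of at most 14 b = 98 x +
      42 y, less than a period, so that the distance is exactly the one tested.\<close>
    finally have "m * (2 * x + y) < 15 * (2 * x + y)" by (simp add: L_def val_def)
    then have "m < 15" by (simp only: mult_less_cancel2)
    then have "D \<le> 14 * (7 * x + 3 * y)" unfolding D_def by (intro mult_le_mono1) simp
    then have "R j < R (i + 37)" using RD R_period[OF i0] x by simp
    then have "e = 0" using je by (cases e) auto
    with je have jd: "j = i + d" by simp
    have "D = val (symgap i (i + d))" using R_symgap[of i j] RD jd by simp
    also have "symgap i (i + d) = symgap i' (i' + d)"
      using symgap_shift[OF i'_bounds(1), of c "i' + d"] by (simp add: ic algebra_simps)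
    finally have DV: "val (symgap i' (i' + d)) = m * (7 * x + 3 * y)" by (simp add: D_def)
    have "(i', d) \<in> {(32, 2), (34, 4), (37, 3)}"
      using S2 DV no_shift[of _ _ m] no_far[of _ _ S m] LS no_48_22[of m]
      by (cases "symgap i' (i' + d)") (auto simp: L_def)
    then have "(i mod 37, j mod 37) \<in> {(32, 34), (34, 1), (0, 3)}"
      by (auto simp: jd ic)
    with that[OF i0 i] True RD show ?thesis by (simp add: L_def D_def)
  next
    case False
    have jL: "s + D + L \<le> R j"
    proof (rule ccontr)
      assume "\<not> s + D + L \<le> R j"
      then have "mark (R j - D)" using agree[of "R j - D"] j j0 by simp
      then obtain i'' where i'': "R j - D = R i''" by (auto simp: mark_def)
      then have "R i \<le> R j - D" using i_least[of i''] j by simp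
      with False \<open>\<not> s + D + L \<le> R j\<close> j show False by simp
    qed
    \<comment> \<open>Two windows inside one gap would span m a letters, but even the first gap has
      only a.\<close>
    have "i \<noteq> j"
    proof
      assume "i = j"
      then have "D + L < val (gs (i - 1))" using jL i1 Ri by simp
      also have "\<dots> \<le> 1 * (9 * x + 4 * y)" using val_mono[OF gs_bounds(2)[of "i - 1"]] by (simp add: val_def)
      also have "\<dots> \<le> m * (9 * x + 4 * y)" using \<open>0 < m\<close> by (intro mult_le_mono1) simp
      finally show False by (simp add: L_def D_def algebra_simps)
    qed
    then obtain d where d: "0 < d" "j = i + d" using ij using that[of "j - i"] by simp
    \<comment> \<open>The gap before \<open>j\<close> is not the exceptional first one, hence at
      most 3 (a - b). This is why only m = 1 and m = 2 are tested.\<close>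
    have "L < val (gs (j - 1))" using jL j1 Rj by simp
    also have "\<dots> \<le> val (6, 3)" using d i0 by (intro val_mono gs_bounds(3)) simp
    finally have "m * (2 * x + y) < 3 * (2 * x + y)" by (simp add: L_def val_def)
    then have "m < 3" by (simp only: mult_less_cancel2)
    then have m: "m = 1 \<or> m = 2" using \<open>0 < m\<close> by linarith
    have E: "R (j - 1) + L < R i + D" using j1 False by simp
    have "d < 37"
    proof (rule ccontr)
      assume "\<not> d < 37"
      then have "R (i + 36) \<le> R (j - 1)" using d by simp
      moreover have "R (i + 37) = R (i + 36) + val (gs (i + 36))" unfolding R_Suc[symmetric] by simp
      moreover have "val (gs (i + 36)) \<le> val (6, 3)" by (intro val_mono gs_bounds(3)) simp
      ultimately show False using E R_period[OF i0] m x by (auto simp: L_def D_def val_def simp del: R_le)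
    qed
    have gs_j: "gs (i' + d - 1) = gs (j - 1)"
      using gs_period_mult[of "i' + d - 1" c] d i'_bounds by (simp add: ic algebra_simps)
    have "zero_test m (symgap i' (i' + d - 1)) (gs (i - 1)) (gs (j - 1))"
      using gap_tests(1,2)[OF i'_bounds d(1) \<open>d < 37\<close>] m unfolding gs_i gs_j by auto
    moreover have "symgap i' (i' + d - 1) = symgap i (j - 1)"
      using symgap_shift[OF i'_bounds(1), of c "i' + d - 1"] d(1) by (simp add: ic d(2) algebra_simps)
    moreover define V where "V = symgap i (j - 1)"
    moreover have RV: "R (j - 1) = R i + val V" using R_symgap[of i "j - 1"] d by (simp add: V_def)
    \<comment> \<open>In turn: the first or the second gap is too short for the window, the gaps are
      too far apart, or they are too close together to hold windows at distance m b.\<close>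
    ultimately consider "val (gs (i - 1)) \<le> val (2 * m, m)" | "val (gs (j - 1)) \<le> val (2 * m, m)"
      | "val (5 * m, 2 * m) \<le> val V"
      | "val (padd V (padd (gs (i - 1)) (gs (j - 1)))) \<le> val (9 * m, 4 * m)"
      unfolding zero_test_def using val_mono by metis
    then have False
    proof cases
      case 1
      with Ri i1 False show ?thesis by (simp add: L_def val_def algebra_simps)
    next
      case 2
      with Rj j1 jL show ?thesis by (simp add: L_def val_def algebra_simps)
    next
      case 3
      with RV E show ?thesis by (simp add: L_def D_def val_def algebra_simps)
    next
      case 4
      moreover have "val (9 * m, 4 * m) = L + D" by (simp add: L_def D_def val_def algebra_simps)
      ultimately show ?thesis using RV Ri Rj i1 jL by simp
    qed
    then show ?thesis ..
  qed
qed

section \<open>The letters of the word\<close>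

definition k :: nat where
  "k = 111 * x + 51 * y"

definition letter_val :: "nat \<Rightarrow> nat \<Rightarrow> nat" where
  "letter_val c l = (if l = 33 then 2 else if l = 39 then c + 2 else 1)"

definition block :: "nat \<Rightarrow> nat \<Rightarrow> nat list" where
  "block c l = replicate (val (gs l) - 1) 0 @ [letter_val c l]"

definition word :: "nat \<Rightarrow> nat list" where
  "word c = concat (map (block c) [3..<40])"

definition prefix :: "nat list" where
  "prefix = concat (map (block 0) [0..<3])"

lemma R_3: "R 3 = 13 * x + 6 * y"
  by (simp add: R_def numeral_3_eq_3 gs_def gaps_def val_def)

lemma R_40: "R 40 = R 3 + k"
  using R_period[of 3] by (simp add: k_def)

lemma k_gt: "R 3 < k" "0 < k"
  using x by (simp_all add: R_3 k_def)

definition z :: "nat \<Rightarrow> nat" where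
  "z = affine_fix prefix word k"

text \<open>Index 3 ends the prefix v and carries 1; index 40 + 37 q ends the image of the letter
  with index q.\<close>

definition mark_val :: "nat \<Rightarrow> nat" where
  "mark_val i = (if i mod 37 = 34 then 2 else if i mod 37 = 3 \<and> 40 \<le> i then z ((i - 40) div 37) + 2 else 1)"

lemma block_length: "length (concat (map (block c) [m..<n])) = (\<Sum>l=m..<n. val (gs l))"
proof (cases "m \<le> n")
  case True
  then show ?thesis by (induction n rule: dec_induct) (simp_all add: block_def Suc_leI)
qed simp

lemma block_nth:
  assumes "m \<le> p" "p < n" "t < val (gs p)"
  shows "concat (map (block c) [m..<n]) ! ((\<Sum>l=m..<p. val (gs l)) + t) =
    (if Suc t = val (gs p) then letter_val c p else 0)"
proof -
  have "[m..<n] = [m..<p] @ p # [Suc p..<n]"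
    using assms upt_add_eq_append[of m p "n - p"] by (simp add: upt_conv_Cons)
  then have "concat (map (block c) [m..<n]) ! ((\<Sum>l=m..<p. val (gs l)) + t) =
      (block c p @ concat (map (block c) [Suc p..<n])) ! t"
    by (simp add: nth_append block_length del: upt_Suc)
  also have "\<dots> = (if Suc t = val (gs p) then letter_val c p else 0)"
    using assms(3) by (auto simp: block_def nth_append)
  finally show ?thesis .
qed

lemma R_sum: "m \<le> n \<Longrightarrow> R n = R m + (\<Sum>l=m..<n. val (gs l))"
  by (induction n rule: dec_induct) (simp_all add: R_Suc)

lemma prefix_length: "length prefix = R 3"
  unfolding prefix_def block_length using R_sum[of 0 3] by simp

lemma word_length: "length (word c) = k"
  unfolding word_def block_length using R_sum[of 3 40] R_40 by simp

lemma R_decomp: obtains l t where "N = R l + t" "t < val (gs l)"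
proof -
  define l where "l = (LEAST l. N < R (Suc l))"
  have "N < R (Suc N)" using R_ge[of "Suc N"] by simp
  then have 1: "N < R (Suc l)" unfolding l_def by (rule LeastI)
  have "R l \<le> N"
  proof (cases l)
    case (Suc l')
    then show ?thesis using not_less_Least[of l' "\<lambda>l. N < R (Suc l)"] by (simp add: l_def)
  qed simp
  with 1 that[of l "N - R l"] show ?thesis by (simp add: R_Suc)
qed

lemma z_prefix: "n < R 3 \<Longrightarrow> z n = prefix ! n"
  unfolding z_def by (subst affine_fix.simps) (simp add: prefix_length)

lemma z_word: "r < k \<Longrightarrow> z (R 3 + k * q + r) = word (z q) ! r"
  using k_gt(2) x R_3 unfolding z_def
  by (subst affine_fix.simps) (simp add: prefix_length flip: length_0_conv)

lemma z_block:
  assumes "t < val (gs l)"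
  shows "z (R l + t) = (if Suc t = val (gs l) then mark_val (Suc l) else 0)"
proof (cases "l < 3")
  case True
  have "R l + t < R (Suc l)" using assms by (simp add: R_Suc)
  also have "R (Suc l) \<le> R 3" using True by simp
  finally have "z (R l + t) = prefix ! (R l + t)" by (rule z_prefix)
  also have "\<dots> = (if Suc t = val (gs l) then letter_val 0 l else 0)"
    using block_nth[of 0 l 3 t 0] assms True R_sum[of 0 l] by (simp add: prefix_def del: upt_Suc)
  also have "letter_val 0 l = mark_val (Suc l)"
    using True by (simp add: letter_val_def mark_val_def)
  finally show ?thesis .
next
  case False
  define r q where "r = (l - 3) mod 37" and "q = (l - 3) div 37"
  have l: "l = 3 + r + 37 * q" using False by (simp add: r_def q_def)
  have r: "r < 37" by (simp add: r_def)
  define S where "S = (\<Sum>l=3..<3 + r. val (gs l))"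
  have gs: "gs l = gs (3 + r)" unfolding l by (rule gs_period_mult) simp
  have RS: "R (3 + r) = R 3 + S" using R_sum[of 3 "3 + r"] by (simp add: S_def)
  have "R (Suc (3 + r)) \<le> R 40" using r by (subst R_le) simp
  then have Sk: "S + t < k" using assms RS R_40 gs unfolding R_Suc by simp
  have "R l = R 3 + k * q + S"
    using R_period_mult[of "3 + r" q] RS by (simp add: l k_def)
  then have "z (R l + t) = word (z q) ! (S + t)" using z_word[OF Sk] by (simp add: add.assoc)
  also have "\<dots> = (if Suc t = val (gs l) then letter_val (z q) (3 + r) else 0)"
    unfolding word_def S_def gs using r assms by (intro block_nth) (simp_all add: gs)
  also have "letter_val (z q) (3 + r) = mark_val (Suc l)"
  proof -
    have "Suc l = 4 + r + 37 * q" by (simp add: l)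
    then have 1: "Suc l mod 37 = (4 + r) mod 37" by (simp only: mod_mult_self2)
    consider "r = 30" | "r = 36" | "r \<noteq> 30" "r \<noteq> 36" by blast
    then show ?thesis
    proof cases
      case 3
      have "(4 + r) mod 37 = (if r < 33 then 4 + r else r - 33)"
        using r le_mod_geq[of 37 "4 + r"] by simp
      with 3 have "Suc l mod 37 \<noteq> 34" "Suc l mod 37 \<noteq> 3" using 1 r by (auto split: if_splits)
      with 3 show ?thesis by (simp add: letter_val_def mark_val_def)
    qed (simp_all add: 1 letter_val_def mark_val_def, simp add: l)
  qed
  finally show ?thesis .
qed

lemma z_mark: "0 < i \<Longrightarrow> z (R i - 1) = mark_val i"
proof -
  assume "0 < i"
  then have "z (R (i - 1) + (val (gs (i - 1)) - 1)) = mark_val i"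
    using z_block[of "val (gs (i - 1)) - 1" "i - 1"] val_gs_pos[of "i - 1"] by simp
  moreover have "R (i - 1) + (val (gs (i - 1)) - 1) = R i - 1"
    using R_pred[OF \<open>0 < i\<close>] val_gs_pos[of "i - 1"] by linarith
  ultimately show ?thesis by simp
qed

lemma z_mark': "0 < i \<Longrightarrow> Suc n = R i \<Longrightarrow> z n = mark_val i"
  using z_mark[of i] by (metis diff_Suc_1)

lemma mark_val_pos: "0 < mark_val i"
  by (simp add: mark_val_def)

lemma z_pos_iff: "0 < z n \<longleftrightarrow> mark (Suc n)"
proof
  obtain l t where *: "n = R l + t" "t < val (gs l)" by (rule R_decomp)
  assume "0 < z n"
  then have "Suc t = val (gs l)" using z_block[OF *(2)] * by (auto split: if_splits)
  then have "Suc n = R (Suc l)" by (simp add: * R_Suc)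
  then show "mark (Suc n)" using mark_R[of "Suc l"] by simp
next
  assume "mark (Suc n)"
  then show "0 < z n" using z_mark' mark_val_pos by (auto simp: mark_def)
qed

lemma word_nth:
  assumes "r < k" shows "word c ! r = (if Suc r = k then c + 2 else word 0 ! r)"
proof -
  obtain l t where *: "R 3 + r = R l + t" "t < val (gs l)" by (rule R_decomp)
  have "R l < R 40" using * assms R_40 by linarith
  moreover have "R 3 < R (Suc l)" unfolding R_Suc using * by linarith
  ultimately have l: "3 \<le> l" "l < 40" by simp_all
  have r: "r = (\<Sum>l=3..<l. val (gs l)) + t" using * R_sum[OF l(1)] by simp
  have w: "word c ! r = (if Suc t = val (gs l) then letter_val c l else 0)" for c
  proof -
    have "word c ! ((\<Sum>l=3..<l. val (gs l)) + t) = (if Suc t = val (gs l) then letter_val c l else 0)"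
      unfolding word_def by (rule block_nth[OF l *(2)])
    then show ?thesis by (simp only: r[symmetric])
  qed
  have "Suc r = k \<longleftrightarrow> l = 39 \<and> Suc t = val (gs l)"
  proof
    assume "Suc r = k"
    then have 1: "R l + Suc t = R 40" using * R_40 by linarith
    then have "R 39 < R (Suc l)" unfolding R_Suc using *(2) R_less[of 39 40] by linarith
    then have "l = 39" using l by (simp only: R_less)
    then show "l = 39 \<and> Suc t = val (gs l)" using 1 R_Suc[of 39] by simp
  next
    assume "l = 39 \<and> Suc t = val (gs l)"
    then have "R l + Suc t = R 40" using R_Suc[of 39] by simp
    then show "Suc r = k" using * R_40 by linarith
  qed
  then show ?thesis by (simp add: w letter_val_def)
qed

lemma z_last: "z (R 3 + k * q + (k - 1)) = z q + 2"
  using z_word[of "k - 1" q] word_nth[of "k - 1" "z q"] k_gt by simp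

lemma z_other: "Suc r < k \<Longrightarrow> z (R 3 + k * q + r) = word 0 ! r"
  using z_word[of r q] word_nth[of r "z q"] by simp

lemma z_R3: "z (R 3 - 1) = 1"
  using z_mark[of 3] by (simp add: mark_val_def)

theorem z_power_free:
  assumes "0 < m"
  shows "\<exists>j<m * (2 * x + y). z (n + j) \<noteq> z (n + j + m * (7 * x + 3 * y))"
  using assms
proof (induction m arbitrary: n rule: less_induct)
  case (less m)
  let ?b = "7 * x + 3 * y" and ?A = "2 * x + y"
  show ?case
  proof (rule ccontr)
    assume "\<not> ?thesis"
    then have eq: "z (n + j) = z (n + j + m * ?b)" if "j < m * ?A" for j using that by blast
    show False
    proof (cases "k dvd m * ?b")
      case False
      have agree: "mark N \<longleftrightarrow> mark (N + m * ?b)" if "Suc n \<le> N" "N < Suc n + m * ?A" for N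
        using eq[of "N - Suc n"] z_pos_iff[of "N - 1"] z_pos_iff[of "N - 1 + m * ?b"] that by simp
      obtain i j where ij: "0 < i" "Suc n \<le> R i" "R i < Suc n + m * ?A" "R j = R i + m * ?b"
          "(i mod 37, j mod 37) \<in> {(32, 34), (34, 1), (0, 3)}"
        by (rule agreeing_windows[OF agree zero_less_Suc less.prems False[unfolded k_def]]) (assumption | blast)+
      have "0 < m * ?b" using less.prems x by simp
      then have "i < j" using ij(4) R_less[of i j] by linarith
      then have j: "0 < j" by simp
      have "mark_val i = mark_val j"
        using eq[of "R i - Suc n"] z_mark[OF ij(1)] z_mark[OF j] ij(2-4) by simp
      \<comment> \<open>This excludes j = 3, whose letter is 1; every later letter of this class is
        at least 2.\<close>
      moreover have "40 \<le> j" if mods: "i mod 37 = 0" "j mod 37 = 3"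
      proof -
        obtain d e where de: "i = 37 * d" "j = 3 + 37 * e"
          using mod_eq_nat_decomp[OF mods(1)] mod_eq_nat_decomp[OF mods(2)] by auto
        have "d \<noteq> 0" using de(1) ij(1) by auto
        then have "e \<noteq> 0" using de \<open>i < j\<close> by (cases "e = 0") auto
        then show ?thesis using de(2) by simp
      qed
      ultimately show False using ij(5) unfolding mark_val_def by (elim insertE emptyE) simp_all
    next
      case True
      then have "k dvd m" using coprime_period unfolding k_def by (metis coprime_commute coprime_dvd_mult_left_iff)
      then obtain m' where m: "m = k * m'" by blast
      then have m': "0 < m'" using less.prems by (cases m') auto
      have "1 < k" using k_gt x by (simp add: k_def)
      then have "m' < m" using m m' by simp
      have kA: "k * (m' * ?A) = m * ?A" "k * (m' * ?b) = m * ?b" by (simp_all add: m)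
      have "1 \<le> m' * ?A" using m' x by simp
      then have "k * 1 \<le> k * (m' * ?A)" by (rule mult_le_mono2)
      then have kL: "k \<le> m * ?A" by (simp add: kA)
      show False
      proof (cases "n < R 3")
        \<comment> \<open>The window contains the end of the prefix v, a letter 1. Moved by a
          multiple of k, it falls on the end of a block, where the letter is at least 2.\<close>
        case True
        have "0 < m' * ?b" using m' x by simp
        then obtain q where q: "m' * ?b = Suc q" by (cases "m' * ?b") auto
        have "m * ?b = k + k * q" using kA(2) q by simp
        then have "R 3 - 1 + m * ?b = R 3 + k * q + (k - 1)"
          using True k_gt(2) by simp
        then have "z (R 3 - 1 + m * ?b) = z q + 2" using z_last by simp
        moreover have "z (R 3 - 1 + m * ?b) = z (R 3 - 1)"
          using eq[of "R 3 - 1 - n"] True k_gt(1) kL by simp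
        ultimately show False using z_R3 by simp
      next
        \<comment> \<open>Restricted to the ends of the blocks, the power becomes one with m' in
          place of m among the earlier letters.\<close>
        case False
        define q where "q = (n - R 3) div k"
        define r where "r = (n - R 3) mod k"
        have n: "n = R 3 + k * q + r" using False by (simp add: q_def r_def)
        have r: "r < k" using k_gt by (simp add: r_def)
        obtain j where j: "j < m' * ?A" "z (q + j) \<noteq> z (q + j + m' * ?b)"
          using less.IH[OF \<open>m' < m\<close> m', of q] by blast
        have "k * Suc j \<le> k * (m' * ?A)" using j(1) by (intro mult_le_mono2) simp
        then have "k * j + (k - 1 - r) < m * ?A" using r kA k_gt(2) by simp
        then have e: "z (n + (k * j + (k - 1 - r))) = z (n + (k * j + (k - 1 - r)) + m * ?b)" by (rule eq)
        have e1: "n + (k * j + (k - 1 - r)) = R 3 + k * (q + j) + (k - 1)"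
          using r by (simp add: n distrib_left)
        have e2: "R 3 + k * (q + j) + (k - 1) + m * ?b = R 3 + k * (q + j + m' * ?b) + (k - 1)"
          using kA(2) by (simp add: distrib_left)
        have "z (q + j) + 2 = z (q + j + m' * ?b) + 2"
          using e unfolding e1 e2 z_last .
        with j(2) show False by simp
      qed
    qed
  qed
qed

section \<open>Lexicographic minimality\<close>

lemma psums_nth: "i \<le> length qs \<Longrightarrow> val (psums p qs ! i) = val p + (\<Sum>l<i. val (qs ! l))"
proof (induction qs arbitrary: p i)
  case (Cons q qs)
  then show ?case by (cases i) (simp_all add: sum.lessThan_Suc_shift add.assoc del: sum.lessThan_Suc)
qed (simp add: val_def)

lemma R_mark_pos: "i < 44 \<Longrightarrow> R i = val (mark_pos ! i)"
proof -
  assume "i < 44"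
  have "gs l = ((9, 4) # gaps @ take 5 gaps) ! l" if "l < i" for l
  proof -
    have "gs l = map gs [0..<112] ! l" using that \<open>i < 44\<close> by (simp del: upt_Suc)
    then show ?thesis using that \<open>i < 44\<close>
      unfolding map_gs by (simp add: nth_Cons' nth_append gaps_length)
  qed
  then have "R i = (\<Sum>l<i. val (((9, 4) # gaps @ take 5 gaps) ! l))"
    unfolding R_def by (intro sum.cong) simp_all
  also have "\<dots> = val (mark_pos ! i)" unfolding mark_pos_psums
    using \<open>i < 44\<close> by (subst psums_nth) (simp_all add: gaps_length val_def)
  finally show ?thesis .
qed

lemma R_mark_pos_shift: "p < 44 \<Longrightarrow> 0 < p \<or> q = 0 \<Longrightarrow> R (p + 37 * q) = val (mark_pos ! p) + q * k"
  using R_period_mult[of p q] R_mark_pos[of p] by (auto simp: k_def)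

lemma mark_val_1: "i mod 37 \<noteq> 3 \<Longrightarrow> i mod 37 \<noteq> 34 \<Longrightarrow> mark_val i = 1"
  by (simp add: mark_val_def)

text \<open>By the conditions \<open>low\<close>, the window holds no marks other than the
  \<open>u\<close> marks before \<open>i\<close>, and the window one distance \<open>D\<close> back
  none other than the \<open>u\<close> marks ending with \<open>j\<close>. These agree in pairs; all
  other positions carry 0 on both sides.\<close>

lemma shifted_window:
  assumes ij: "R i \<le> R (Suc j) + D" "u < i" "u \<le> j"
    and match: "\<And>v. v < u \<Longrightarrow> R (j - v) + D = R (i - 1 - v) \<and> mark_val (j - v) = mark_val (i - 1 - v)"
    and low: "R (i - 1 - u) + L \<le> R i" "R (j - u) + D + L \<le> R i"
    and N: "R i - L < N" "N < R i"
  shows "z (N - 1) = z (N - 1 - D)"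
proof -
  have ND: "R (j - u) < N - D" "D < N" "N - D < R (Suc j)" using low(2) N ij(1) by linarith+
  show ?thesis
  proof (cases "\<exists>v<u. N = R (i - 1 - v)")
    case True
    then obtain v where v: "v < u" "N = R (i - 1 - v)" by blast
    then have "N - D = R (j - v)" using conjunct1[OF match[OF v(1)]] by linarith
    moreover have "N - 1 - D = N - D - 1" by simp
    ultimately show ?thesis using v match[of v] ij z_mark[of "i - 1 - v"] z_mark[of "j - v"] by simp
  next
    case False
    have "\<not> mark N"
    proof
      assume "mark N"
      then obtain l where l: "N = R l" by (auto simp: mark_def)
      have "R (i - 1 - u) < R l" using low(1) N l by linarith
      then have "i - 1 - u < l" by simp
      moreover have "l < i" using N l by simp
      ultimately have "i - 1 - l < u" "l = i - 1 - (i - 1 - l)" by linarith+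
      with False l show False by metis
    qed
    moreover have "\<not> mark (N - D)"
    proof
      assume "mark (N - D)"
      then obtain l where l: "N - D = R l" by (auto simp: mark_def)
      have "j - u < l" "l < Suc j" using ND l by simp_all
      then have v: "j - l < u" "l = j - (j - l)" by linarith+
      have "R (j - (j - l)) = R l" using v(2) by simp
      then have "N = R (i - 1 - (j - l))" using conjunct1[OF match[OF v(1)]] l ND by linarith
      with False v(1) show False by blast
    qed
    moreover have "Suc (N - 1 - D) = N - D" "Suc (N - 1) = N" using ND by simp_all
    ultimately show ?thesis using z_pos_iff[of "N - 1"] z_pos_iff[of "N - 1 - D"] by simp
  qed
qed

lemma witness_window:
  assumes ok: "witness_ok (i, m, j, u)" and i: "i < 43" "q = 0 \<or> 6 \<le> i"
  defines "I \<equiv> i + 37 * q" and "D \<equiv> m * (7 * x + 3 * y)" and "L \<equiv> m * (2 * x + y)"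
  shows "0 < m" "D + L \<le> R I" "R I - L < N \<Longrightarrow> N < R I \<Longrightarrow> z (N - 1) = z (N - 1 - D)"
    "witness_zero (i, m, j, u) \<Longrightarrow> z (R I - 1 - D) = 0"
    "\<not> witness_zero (i, m, j, u) \<Longrightarrow> Suc j mod 37 \<noteq> 3 \<Longrightarrow> Suc j mod 37 \<noteq> 34 \<Longrightarrow> z (R I - 1 - D) = 1"
proof -
  let ?D = "(7 * m, 3 * m)" and ?L = "(2 * m, m)"
  have D: "val ?D = D" and L: "val ?L = L" by (simp_all add: val_def D_def L_def algebra_simps)
  have ok1: "0 < m" "u < i" "u \<le> j" "j < i" "i < 6 \<or> u < j \<and> u + 1 < i"
     "ple (padd (mark_pos ! j) ?D) (mark_pos ! i)" "padd (mark_pos ! j) ?D \<noteq> mark_pos ! i"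
     "ple (mark_pos ! i) (padd (mark_pos ! Suc j) ?D)"
     "ple (padd (mark_pos ! (i - 1 - u)) ?L) (mark_pos ! i)"
     "ple (padd (padd (mark_pos ! (j - u)) ?D) ?L) (mark_pos ! i)"
     and ok2: "\<And>v. v < u \<Longrightarrow> padd (mark_pos ! (j - v)) ?D = mark_pos ! (i - 1 - v) \<and>
       (j - v) mod 37 \<noteq> 3 \<and> (j - v) mod 37 \<noteq> 34 \<and>
       (i - 1 - v) mod 37 \<noteq> 3 \<and> (i - 1 - v) mod 37 \<noteq> 34"
    using ok by (simp_all add: witness_ok_def Let_def list_all_iff)
  show "0 < m" by fact
  have D0: "0 < D" using ok1(1) x by (simp add: D_def)
  let ?J = "j + 37 * q"
  have jq: "u < j \<or> q = 0" "u + 1 < i \<or> q = 0" using ok1(5) i(2) by auto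
  have RI: "R I = val (mark_pos ! i) + q * k" unfolding I_def using ok1 i by (intro R_mark_pos_shift) auto
  have RJ: "R ?J = val (mark_pos ! j) + q * k" using ok1 i jq by (intro R_mark_pos_shift) auto
  have RJ1: "R (Suc ?J) = val (mark_pos ! Suc j) + q * k"
    using R_mark_pos_shift[of "Suc j" q] ok1 i by simp
  have Ru: "R (I - 1 - u) = val (mark_pos ! (i - 1 - u)) + q * k"
  proof -
    have "I - 1 - u = i - 1 - u + 37 * q" using ok1 by (simp add: I_def)
    then show ?thesis using ok1 i jq R_mark_pos_shift[of "i - 1 - u" q] by auto
  qed
  have Rju: "R (?J - u) = val (mark_pos ! (j - u)) + q * k"
  proof -
    have "?J - u = j - u + 37 * q" using ok1 by simp
    then show ?thesis using ok1 i jq R_mark_pos_shift[of "j - u" q] by auto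
  qed
  have 1: "R I \<le> R (Suc ?J) + D" using val_mono[OF ok1(8)] RI RJ1 D by simp
  have 2: "R (I - 1 - u) + L \<le> R I" using val_mono[OF ok1(9)] RI Ru L by simp
  have 3: "R (?J - u) + D + L \<le> R I" using val_mono[OF ok1(10)] RI Rju D L by simp
  have 4: "R ?J + D < R I" using val_strict_mono[OF ok1(6,7)] RI RJ D by simp
  show "D + L \<le> R I" using 3 by simp
  show "z (N - 1) = z (N - 1 - D)" if "R I - L < N" "N < R I"
  proof (rule shifted_window[OF 1 _ _ _ 2 3 that])
    show "u < I" "u \<le> ?J" using ok1 by (simp_all add: I_def)
    fix v assume v: "v < u"
    have eq: "?J - v = j - v + 37 * q" "I - 1 - v = i - 1 - v + 37 * q" using v ok1 by (simp_all add: I_def)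
    have "mark_val (?J - v) = 1" "mark_val (I - 1 - v) = 1"
      using ok2[OF v] unfolding eq by (simp_all add: mark_val_1)
    moreover have "R (?J - v) + D = R (I - 1 - v)"
    proof -
      have "val (padd (mark_pos ! (j - v)) ?D) = val (mark_pos ! (i - 1 - v))" using ok2[OF v] by simp
      moreover have "R (?J - v) = val (mark_pos ! (j - v)) + q * k"
        unfolding eq using v ok1 i by (intro R_mark_pos_shift) auto
      moreover have "R (I - 1 - v) = val (mark_pos ! (i - 1 - v)) + q * k"
        unfolding eq using v ok1 i by (intro R_mark_pos_shift) auto
      ultimately show ?thesis using D by simp
    qed
    ultimately show "R (?J - v) + D = R (I - 1 - v) \<and> mark_val (?J - v) = mark_val (I - 1 - v)" by simp
  qed
  have S: "Suc (R I - 1 - D) = R I - D" using 4 by simp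
  show "z (R I - 1 - D) = 0" if "witness_zero (i, m, j, u)"
  proof -
    have "padd (mark_pos ! Suc j) ?D \<noteq> mark_pos ! i" using that by (simp add: witness_zero_def)
    then have "R I < R (Suc ?J) + D" using val_strict_mono[OF ok1(8)] RI RJ1 D by simp
    then have "R I - D < R (Suc ?J)" "R ?J < R I - D" using 4 by linarith+
    then have "\<not> mark (R I - D)" using mark_between[of "R I - D" ?J] by linarith
    then show ?thesis using z_pos_iff[of "R I - 1 - D"] S by simp
  qed
  show "z (R I - 1 - D) = 1" if "\<not> witness_zero (i, m, j, u)" "Suc j mod 37 \<noteq> 3" "Suc j mod 37 \<noteq> 34"
  proof -
    have "padd (mark_pos ! Suc j) ?D = mark_pos ! i" using that by (simp add: witness_zero_def)
    then have "val (padd (mark_pos ! Suc j) ?D) = val (mark_pos ! i)" by simp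
    then have "R I - D = R (Suc ?J)" using RI RJ1 D by simp
    then have "z (R I - 1 - D) = mark_val (Suc j + 37 * q)" using z_mark'[of "Suc ?J"] S by simp
    also have "\<dots> = 1" using that by (intro mark_val_1) simp_all
    finally show ?thesis .
  qed
qed

text \<open>Writing \<open>c\<close> at \<open>n\<close> completes a power of period m b that ends
  at \<open>n\<close>: the case t = 0 is the new letter itself, and the bound on m a keeps the power
  inside the word.\<close>

theorem z_smaller_letter:
  assumes "c < z n"
  obtains m where "0 < m" "m * (9 * x + 4 * y) \<le> Suc n" "z (n - m * (7 * x + 3 * y)) = c"
    "\<And>t. 0 < t \<Longrightarrow> t < m * (2 * x + y) \<Longrightarrow> z (n - t) = z (n - t - m * (7 * x + 3 * y))"
proof -
  have "\<exists>m. 0 < m \<and> m * (9 * x + 4 * y) \<le> Suc n \<and> z (n - m * (7 * x + 3 * y)) = c \<and>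
    (\<forall>t. 0 < t \<longrightarrow> t < m * (2 * x + y) \<longrightarrow> z (n - t) = z (n - t - m * (7 * x + 3 * y)))"
    using assms
  proof (induction n arbitrary: c rule: less_induct)
    case (less n)
    let ?a = "9 * x + 4 * y" and ?b = "7 * x + 3 * y" and ?A = "2 * x + y"
    have "mark (Suc n)" using less.prems z_pos_iff[of n] by simp
    then obtain I where I: "0 < I" "Suc n = R I" by (auto simp: mark_def)
    have zn: "z n = mark_val I" using z_mark' I by simp
    \<comment> \<open>The marks 1 to 5 have their own entries because the word begins there; all
      later ones reduce to 6 to 42.\<close>
    define q where "q = (if I < 43 then 0 else (I - 6) div 37)"
    define i where "i = (if I < 43 then I else (I - 6) mod 37 + 6)"
    have iq: "I = i + 37 * q" "0 < i" "i < 43" "q = 0 \<or> 6 \<le> i"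
    proof -
      show "I = i + 37 * q"
      proof (cases "I < 43")
        case False
        then have "I = 6 + (I - 6)" by simp
        also have "\<dots> = 6 + (37 * ((I - 6) div 37) + (I - 6) mod 37)" by (simp only: mult_div_mod_eq)
        finally show ?thesis using False by (simp add: i_def q_def)
      qed (simp add: i_def q_def)
      show "0 < i" "i < 43" "q = 0 \<or> 6 \<le> i"
        using I mod_less_divisor[of 37 "I - 6"] by (simp_all add: i_def q_def)
    qed
    have window: ?case if w: "witness_ok (i, m, j, u)"
      and c: "z (R (i + 37 * q) - 1 - m * ?b) = c" for m j u
    proof (intro exI conjI allI impI)
      note W = witness_window[OF w iq(3,4)]
      have W': "0 < m" "m * ?b + m * ?A \<le> Suc n"
        "\<And>N. Suc n - m * ?A < N \<Longrightarrow> N < Suc n \<Longrightarrow> z (N - 1) = z (N - 1 - m * ?b)"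
        using W(1-3) iq(1) I(2) by simp_all
      show "0 < m" by fact
      show "m * ?a \<le> Suc n" using W'(2) by (simp add: algebra_simps)
      show "z (n - m * ?b) = c" using c iq(1) I(2) by (metis diff_Suc_1)
      fix t assume "0 < t" "t < m * ?A"
      then show "z (n - t) = z (n - t - m * ?b)" using W'(2) W'(3)[of "Suc n - t"] by simp
    qed
    have wit: "map fst witnesses = [1..<43]"
      "\<And>w. w \<in> set witnesses \<Longrightarrow> witness_ok w \<and> witness_zero w"
      "witness_ok (34, 1, 31, 0)" "\<not> witness_zero (34, 1, 31, 0)"
      "witness_ok (40, 1, 36, 0)" "\<not> witness_zero (40, 1, 36, 0)"
      using witnesses_ok by (simp_all add: list_all_iff del: upt_Suc)
    consider "c = 0" | "c = 1" | "2 \<le> c" by linarith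
    then show ?case
    proof cases
      case 1
      have "i \<in> fst ` set witnesses" using iq unfolding set_map[symmetric] wit(1) by simp
      then obtain m j u where w: "(i, m, j, u) \<in> set witnesses" by force
      show ?thesis
        using window[of m j u] witness_window(4)[OF _ iq(3,4), of m j u] wit(2)[OF w] 1 by blast
    next
      case 2
      have "I mod 37 = 34 \<or> I mod 37 = 3 \<and> 40 \<le> I"
        using less.prems 2 unfolding zn mark_val_def by (auto split: if_splits)
      then have "i = 34 \<or> i = 40"
      proof
        assume "I mod 37 = 34"
        then have "i mod 37 = 34" by (simp add: iq(1))
        then obtain d where "i = 34 + 37 * d" using mod_eq_nat_decomp by blast
        then show ?thesis using iq(3) by (cases d) auto
      next
        assume *: "I mod 37 = 3 \<and> 40 \<le> I"
        then have "i mod 37 = 3" by (simp add: iq(1))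
        then obtain d where d: "i = 3 + 37 * d" using mod_eq_nat_decomp by blast
        then have "d < 2" using iq(3) by simp
        then have "i = 3 \<or> i = 40" using d by (auto simp: less_2_cases_iff)
        then show ?thesis using * iq by auto
      qed
      then show ?thesis
      proof
        assume i: "i = 34"
        show ?thesis
          using window[of 1 31 0] witness_window(5)[OF _ iq(3,4), of 1 31 0] wit(3,4)[folded i] 2
          by simp
      next
        assume i: "i = 40"
        show ?thesis
          using window[of 1 36 0] witness_window(5)[OF _ iq(3,4), of 1 36 0] wit(5,6)[folded i] 2
          by simp
      qed
    next
      \<comment> \<open>A letter above 2 ends a block and is z p + 2 for an earlier
        \<open>p\<close>, so lowering it to \<open>c\<close> is lowering z p to c - 2. The resulting
        power is stretched by k.\<close>
      case 3
      have I40: "I mod 37 = 3" "40 \<le> I" and zn': "z n = z ((I - 40) div 37) + 2"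
        using less.prems 3 unfolding zn mark_val_def by (auto split: if_splits)
      define p where "p = (I - 40) div 37"
      have Ip: "I = 40 + 37 * p"
      proof -
        obtain d where d: "I = 3 + 37 * d" using I40(1) mod_eq_nat_decomp by blast
        with I40(2) show ?thesis by (cases d) (simp_all add: p_def)
      qed
      have n: "n = R 3 + k * p + (k - 1)"
      proof -
        have "Suc n = R 3 + k * p + k"
          using I(2) R_period_mult[of 40 p] R_40 by (simp add: Ip k_def)
        then show ?thesis using k_gt(2) by simp
      qed
      have "1 * p \<le> k * p" using k_gt(2) by (intro mult_le_mono1) simp
      moreover have "0 < R 3" using x by (simp add: R_3)
      ultimately have "p < n" unfolding n by linarith
      moreover have "c - 2 < z p" using less.prems zn' 3 by (simp add: p_def)
      ultimately obtain m where m: "0 < m" "m * ?a \<le> Suc p" "z (p - m * ?b) = c - 2"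
        "\<And>t. 0 < t \<Longrightarrow> t < m * ?A \<Longrightarrow> z (p - t) = z (p - t - m * ?b)"
        using less.IH by blast
      have ab: "m * ?a = m * ?A + m * ?b" by (simp add: algebra_simps)
      have A1: "1 \<le> m * ?A" using m(1) x by simp
      have kb: "k * m * ?b = k * (m * ?b)" "k * m * ?A = k * (m * ?A)" by simp_all
      have "k * (m * ?a) \<le> k * Suc p" by (rule mult_le_mono2[OF m(2)])
      then have 1: "k * m * ?a \<le> Suc n" using k_gt(2) by (simp add: n mult.assoc)
      have shift: "n - k * s = R 3 + k * (p - s) + (k - 1)" if sp: "s \<le> p" for s
      proof -
        obtain d where "p = s + d" using le_Suc_ex[OF sp] by blast
        then show ?thesis by (simp add: n distrib_left)
      qed
      have 2: "z (n - k * m * ?b) = c"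
        using shift[of "m * ?b"] z_last[of "p - m * ?b"] m(2,3) ab A1 3 by (simp add: kb)
      have "z (n - t) = z (n - t - k * m * ?b)" if t: "0 < t" "t < k * m * ?A" for t
      proof -
        define s r where "s = t div k" and "r = t mod k"
        have ts: "t = k * s + r" by (simp add: s_def r_def)
        have r: "r < k" using k_gt(2) by (simp add: r_def)
        have "k * s < k * (m * ?A)" using t ts kb by linarith
        then have s: "s < m * ?A" by simp
        have sp: "s + m * ?b \<le> p" using s m(2) ab by simp
        define B where "B = m * ?b"
        obtain d where d: "p = s + B + d" using le_Suc_ex[OF sp] unfolding B_def by blast
        have n': "n = k * s + (k * B + (R 3 + k * d + (k - 1)))" by (simp add: n d distrib_left)
        have "n - t = k * B + (R 3 + k * d + (k - 1)) - r" unfolding n' ts by simp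
        then have e1: "n - t = R 3 + k * (p - s) + (k - 1 - r)" using r by (simp add: d distrib_left)
        have "n - t - k * m * ?b = R 3 + k * d + (k - 1) - r" unfolding n' ts kb B_def[symmetric] by simp
        then have e2: "n - t - k * m * ?b = R 3 + k * (p - s - m * ?b) + (k - 1 - r)"
          using r unfolding B_def[symmetric] by (simp add: d)
        show ?thesis
        \<comment> \<open>Ends of blocks are governed by the earlier power; elsewhere the letter
          depends only on the offset in its block, which a multiple of k preserves.\<close>
        proof (cases "r = 0")
          case True
          then have "0 < s" using t ts by (cases s) auto
          then show ?thesis unfolding e2 unfolding e1 True using m(4)[of s] s z_last by simp
        next
          case False
          then show ?thesis unfolding e2 unfolding e1 using z_other[of "k - 1 - r"] r by simp
        qed
      qed
      with 1 2 m(1) k_gt(2) show ?thesis by (intro exI[of _ "k * m"]) simp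
    qed
  qed
  with that show thesis by blast
qed

section \<open>The fixed point of the morphism\<close>

lemma phi_num_word:
  assumes "a = 9 * x + 4 * y" "b = 7 * x + 3 * y"
  shows "phi_num a b c = map Num (word c)"
proof -
  have gs_upt: "map gs [3..<40] = drop 2 gaps @ take 2 gaps"
  proof -
    have "map gs [3..<40] = take 37 (drop 3 (map gs [0..<112]))"
      by (simp add: take_map drop_map take_upt drop_upt del: upt_Suc)
    then show ?thesis by (simp add: map_gs gaps_length)
  qed
  have "map (\<lambda>l. (val (gs l) - 1, letter_val c l)) [3..<40] =
      zip (map (\<lambda>p. val p - 1) (map gs [3..<40])) (map (letter_val c) [3..<40])"
    by (simp add: zip_map_map zip_same_conv_map comp_def del: upt_Suc)
  also have "map (letter_val c) [3..<40] = replicate 30 1 @ [2] @ replicate 5 1 @ [c + 2]"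
    by (simp add: letter_val_def upt_rec_numeral numeral_eq_Suc)
  finally have ps: "map (\<lambda>l. (val (gs l) - 1, letter_val c l)) [3..<40] =
      zip (map (\<lambda>p. val p - 1) (drop 2 gaps @ take 2 gaps)) (replicate 30 1 @ [2] @ replicate 5 1 @ [c + 2])"
    unfolding gs_upt .
  have e: "a - b = 2 * x + y" "2 * a - 2 * b = 4 * x + 2 * y" "2 * b - a = 5 * x + 2 * y"
      "3 * b - 2 * a = 3 * x + y" "4 * a - 5 * b = x + y" "5 * a - 6 * b = 3 * x + 2 * y"
      "3 * a - 3 * b = 6 * x + 3 * y" "4 * b - 3 * a = x"
    using assms by simp_all
  have "map Num (word c) = blocks (map (\<lambda>l. (val (gs l) - 1, letter_val c l)) [3..<40])"
    by (simp add: word_def blocks_def block_def[abs_def] map_concat comp_def del: upt_Suc)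
  also have "map (\<lambda>l. (val (gs l) - 1, letter_val c l)) [3..<40] =
    [(a - b - 1, 1), (2*a - 2*b - 1, 1), (2*b - a - 1, 1), (2*a - 2*b - 1, 1),
     (a - b - 1, 1), (3*b - 2*a - 1, 1), (4*a - 5*b - 1, 1), (2*b - a - 1, 1),
     (2*a - 2*b - 1, 1), (a - b - 1, 1), (3*b - 2*a - 1, 1), (3*b - 2*a - 1, 1),
     (5*a - 6*b - 1, 1), (3*b - 2*a - 1, 1), (4*a - 5*b - 1, 1), (a - b - 1, 1),
     (3*b - 2*a - 1, 1), (3*a - 3*b - 1, 1), (3*b - 2*a - 1, 1), (a - b - 1, 1),
     (4*b - 3*a - 1, 1), (5*a - 6*b - 1, 1), (2*a - 2*b - 1, 1), (a - b - 1, 1),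
     (3*b - 2*a - 1, 1), (3*a - 3*b - 1, 1), (3*b - 2*a - 1, 1), (4*a - 5*b - 1, 1),
     (a - b - 1, 1), (3*b - 2*a - 1, 1), (2*a - 2*b - 1, 2), (a - b - 1, 1),
     (3*b - 2*a - 1, 1), (3*a - 3*b - 1, 1), (3*b - 2*a - 1, 1), (a - b - 1, 1),
     (a - b - 1, c + 2)]"
    unfolding ps e by (simp add: gaps_def val_def numeral_eq_Suc)
  finally show ?thesis by (simp only: phi_num_def)
qed

text \<open>The letter 0' occurs only at the beginning: no image of a number contains it, and its
  own image contains it only in front.\<close>

definition letters :: "letter stream" where
  "letters = smap (\<lambda>n. if n = 0 then ZeroPrime else Num (z n)) nats"

lemma letters_nth: "letters !! n = (if n = 0 then ZeroPrime else Num (z n))"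
  by (simp add: letters_def)

lemma phi_ZeroPrime:
  assumes "a = 9 * x + 4 * y" "b = 7 * x + 3 * y"
  shows "phi a b ZeroPrime = ZeroPrime # map Num (tl prefix) @ map Num (word 0)"
    and "prefix = 0 # tl prefix"
proof -
  have "2 \<le> a" "a - b = 2 * x + y" using assms x by simp_all
  then obtain a' where a': "9 * x + 4 * y = Suc (Suc a')" "a = Suc (Suc a')"
    using assms(1) by (metis add_2_eq_Suc le_Suc_ex)
  have p: "prefix = replicate (Suc a') 0 @ [1] @ replicate (2 * x + y - 1) 0 @ [1] @ replicate (2 * x + y - 1) 0 @ [1]"
  proof -
    have "prefix = block 0 0 @ block 0 1 @ block 0 2"
      unfolding prefix_def by (simp add: numeral_3_eq_3 numeral_2_eq_2)
    moreover have "val (gs 0) - 1 = Suc a'" "val (gs 1) = 2 * x + y" "val (gs 2) = 2 * x + y"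
      using a' assms(1) by (simp_all add: gs_def gaps_def val_def)
    ultimately show ?thesis by (simp add: block_def letter_val_def)
  qed
  show "prefix = 0 # tl prefix" by (simp add: p)
  show "phi a b ZeroPrime = ZeroPrime # map Num (tl prefix) @ map Num (word 0)"
    using a'(2) unfolding p phi.simps phi_num_word[OF assms] \<open>a - b = 2 * x + y\<close> by (simp add: blocks_def)
qed

lemma z_0: "z 0 = 0"
  using z_pos_iff[of 0] R_ge[of 2] R_strict_mono mark_between[of "Suc 0" 0] gs_bounds
  by (cases "z 0 = 0") (use x in \<open>auto simp: R_Suc val_def\<close>)

lemma morph_fix_letters:
  assumes "a = 9 * x + 4 * y" "b = 7 * x + 3 * y"
  shows "morph_fix (phi a b) ZeroPrime = letters"
proof (rule morph_fix_eqI)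
  have w: "word c \<noteq> []" for c using word_length[of c] k_gt by auto
  show ne: "phi a b c \<noteq> []" for c
    using w phi_ZeroPrime[OF assms] phi_num_word[OF assms] by (cases c) auto
  show "2 \<le> length (phi a b ZeroPrime)"
    using w[of 0] unfolding phi_ZeroPrime(1)[OF assms] by (cases "word 0") simp_all
  show shd: "shd letters = ZeroPrime" using letters_nth[of 0] by simp
  have "flat (smap (phi a b) letters) !! n = letters !! n" for n
  proof -
    \<comment> \<open>The letter at n past the prefix lies in the image of a letter with index at
      most n, so n + 1 images are enough.\<close>
    define Q where "Q = Suc n"
    have "concat (map (phi a b) (stake Q letters)) = ZeroPrime # map Num (tl prefix) @ concat (map (\<lambda>i. map Num (word (z i))) [0..<Q])"
    proof -
      have "stake Q letters = map (\<lambda>i. letters !! i) [0..<Q]"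
        by (rule nth_equalityI) simp_all
      also have "\<dots> = ZeroPrime # map (\<lambda>i. Num (z i)) [Suc 0..<Q]"
        unfolding Q_def by (subst upt_conv_Cons) (simp_all add: letters_nth shd del: upt_Suc)
      also have "concat (map (phi a b) \<dots>) = ZeroPrime # map Num (tl prefix) @ map Num (word (z 0)) @
          concat (map (\<lambda>i. map Num (word (z i))) [Suc 0..<Q])"
        by (simp add: phi_ZeroPrime(1)[OF assms] phi_num_word[OF assms] comp_def z_0 del: upt_Suc phi.simps(2))
      also have "\<dots> = ZeroPrime # map Num (tl prefix) @ concat (map (\<lambda>i. map Num (word (z i))) [0..<Q])"
        unfolding Q_def by (subst (2) upt_conv_Cons) (simp_all del: upt_Suc)
      finally show ?thesis .
    qed
    moreover define P where "P = ZeroPrime # map Num (tl prefix)"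
    moreover define W where "W = concat (map (\<lambda>i. map Num (word (z i))) [0..<Q])"
    ultimately have "flat (smap (phi a b) letters) = (P @ W) @- flat (smap (phi a b) (sdrop Q letters))"
      using flat_smap_stake[of "phi a b", OF ne, of letters Q] by (simp only: append_Cons)
    then have flat: "flat (smap (phi a b) letters) !! n = (P @ W) ! n" if "n < length (P @ W)"
      using shift_snth_less[OF that] by (simp only:)
    have lenP: "length P = R 3"
      using prefix_length x by (simp add: P_def R_3)
    have lenW: "length W = k * Q" by (simp add: W_def length_concat comp_def word_length sum_list_triv)
    show ?thesis
    proof (cases "n < R 3")
      case True
      then have "flat (smap (phi a b) letters) !! n = P ! n"
        using flat lenP by (simp add: nth_append)
      also have "\<dots> = letters !! n"
      proof (cases n)
        case (Suc n')
        then have "prefix ! n = tl prefix ! n'" "n' < length (tl prefix)"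
          using True prefix_length by (simp_all add: nth_tl)
        then show ?thesis using z_prefix[OF True] Suc by (simp add: P_def letters_nth del: snth.simps)
      qed (simp add: P_def shd)
      finally show ?thesis .
    next
      case False
      define q r where "q = (n - R 3) div k" and "r = (n - R 3) mod k"
      have n: "n = R 3 + (k * q + r)" using False by (simp add: q_def r_def)
      have r: "r < k" using k_gt by (simp add: r_def)
      have "1 * q \<le> k * q" using k_gt by (intro mult_le_mono1) simp
      then have q: "q < Q" unfolding Q_def using n by linarith
      have "k * Suc q \<le> k * Q" using q by (intro mult_le_mono2) simp
      then have kQ: "k * q + r < k * Q" using r by simp
      then have "flat (smap (phi a b) letters) !! n = W ! (k * q + r)"
        using flat lenP lenW by (simp add: n nth_append)
      also have "\<dots> = map Num (word (z q)) ! r"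
        unfolding W_def using q r by (intro concat_uniform_nth) (simp_all add: word_length)
      also have "\<dots> = Num (z n)"
        using r z_word[OF r, of q] by (simp add: n word_length add.assoc)
      also have "\<dots> = letters !! n"
        using n x by (simp add: letters_nth R_3 del: snth.simps)
      finally show ?thesis .
    qed
  qed
  then have "snth (flat (smap (phi a b) letters)) = snth letters" by blast
  then show "flat (smap (phi a b) letters) = letters" by (metis stream_smap_nats)
qed

lemma tau_letters: "smap tau letters !! n = z n"
  by (simp add: letters_nth z_0)

lemma w_letters:
  assumes ab: "a = 9 * x + 4 * y" "b = 7 * x + 3 * y"
  shows "w a b = smap tau letters"
proof (rule w_eqI)
  have ab': "b < a" "a < 2 * b" "a - b = 2 * x + y" "0 < b" using x ab by simp_all
  show "power_free a b (smap tau letters)"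
    unfolding power_free_iff[OF ab'(1,2)] tau_letters ab'(3) using z_power_free ab by blast
  fix t :: "nat stream" assume "power_free a b t"
  then have t: "\<exists>j<m * (2 * x + y). t !! (i + j) \<noteq> t !! (i + j + m * b)" if "0 < m" for m i
    using that unfolding power_free_iff[OF ab'(1,2)] ab'(3) by blast
  show "smap tau letters = t \<or> lex_less (smap tau letters) t"
  proof (cases "\<exists>n. t !! n \<noteq> z n")
    case False
    then have "snth (smap tau letters) = snth t" using tau_letters by (intro ext) metis
    then show ?thesis by (metis stream_smap_nats)
  next
    case True
    define n where "n = (LEAST n. t !! n \<noteq> z n)"
    have n: "t !! n \<noteq> z n" unfolding n_def by (rule LeastI_ex[OF True])
    have less: "t !! i = z i" if "i < n" for i using not_less_Least[of i "\<lambda>n. t !! n \<noteq> z n"] that by (auto simp: n_def)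
    have "\<not> t !! n < z n"
    proof
      assume "t !! n < z n"
      then obtain m where m: "0 < m" "m * (9 * x + 4 * y) \<le> Suc n" "z (n - m * (7 * x + 3 * y)) = t !! n"
        "\<And>t. 0 < t \<Longrightarrow> t < m * (2 * x + y) \<Longrightarrow> z (n - t) = z (n - t - m * (7 * x + 3 * y))"
        using z_smaller_letter[of "t !! n" n] by blast
      define A where "A = m * (2 * x + y)"
      define B where "B = m * b"
      have AB: "A + B \<le> Suc n" "0 < B" using m(1,2) ab'(4) by (simp_all add: A_def B_def ab algebra_simps)
      note m = m[folded ab(2), folded A_def B_def]
      obtain j where j: "j < A" "t !! (Suc n - (A + B) + j) \<noteq> t !! (Suc n - (A + B) + j + B)"
        using t[OF m(1), of "Suc n - (A + B)"] by (auto simp: A_def B_def)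
      \<comment> \<open>The offset is counted from the end of the window, where the changed letter
        stands.\<close>
      define s where "s = A - 1 - j"
      have s: "Suc n - (A + B) + j + B = n - s" "Suc n - (A + B) + j = n - s - B" "s < A"
        using j(1) AB(1) by (simp_all add: s_def)
      show False
      proof (cases "s = 0")
        case True
        then show False using j(2) m(3) less[of "n - B"] s AB by auto
      next
        case False
        then show False using j(2) m(4)[of s] less[of "n - s"] less[of "n - s - B"] s AB by auto
      qed
    qed
    then have "z n < t !! n" using n by simp
    with less have "(\<forall>i<n. z i = t !! i) \<and> z n < t !! n" by metis
    then show ?thesis unfolding lex_less_iff tau_letters by blast
  qed
qed

section \<open>Regularity\<close>

text \<open>
  The last letters of the blocks sit at the positions \<open>k (i + 1) + R 3 - 1\<close>, so the sections of the
  word involve the word delayed by one, with a correction at 0.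
\<close>

definition delayed :: "nat \<Rightarrow> int" where
  "delayed i = (if i = 0 then 0 else int (z (i - 1)))"

definition start :: "nat \<Rightarrow> int" where
  "start i = (if i = 0 then 1 else 0)"

definition sections :: "(nat \<Rightarrow> int) set" where
  "sections = int_seq.span {\<lambda>i. int (z i), delayed, \<lambda>i. 1, start}"

lemma in_sections: "(\<lambda>i. c * int (z i) + d * delayed i + e + f * start i) \<in> sections"
proof -
  have "seq_scale c (\<lambda>i. int (z i)) + seq_scale d delayed + seq_scale e (\<lambda>i. 1) + seq_scale f start \<in> sections"
    unfolding sections_def by (intro int_seq.span_add int_seq.span_scale int_seq.span_base) simp_all
  then show ?thesis by (simp add: seq_scale_def plus_fun_def)
qed

lemma in_sections_eq:
  assumes "\<And>i. g i = c * int (z i) + d * delayed i + e + f * start i"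
  shows "g \<in> sections"
proof -
  have "g = (\<lambda>i. c * int (z i) + d * delayed i + e + f * start i)" using assms by (rule ext)
  then show ?thesis using in_sections by simp
qed

text \<open>Blocks begin at R 3 modulo k. From R 3 on the section is constant; at R 3 - 1 it runs
  through the ends of the preceding blocks, and below that it is constant except in the prefix, at i
  = 0.\<close>

lemma z_section: "j < k \<Longrightarrow> (\<lambda>i. int (z (k * i + j))) \<in> sections"
proof -
  assume j: "j < k"
  consider "R 3 \<le> j" | "Suc j = R 3" | "Suc j < R 3" by linarith
  then show ?thesis
  proof cases
    case 1
    have "z (k * i + j) = word 0 ! (j - R 3)" for i
      using z_other[of "j - R 3" i] 1 j x by (simp add: R_3)
    then show ?thesis by (intro in_sections_eq[of _ 0 0 "int (word 0 ! (j - R 3))" 0]) simp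
  next
    case 2
    have "int (z (k * i + j)) = delayed i + 2 - start i" for i
    proof (cases i)
      case 0
      then show ?thesis using 2 z_R3 by (simp add: delayed_def start_def flip: 2)
    next
      case (Suc i')
      have e: "k * i + j = R 3 + k * i' + (k - 1)" using 2 k_gt by (simp add: Suc)
      show ?thesis unfolding e z_last by (simp add: delayed_def start_def Suc)
    qed
    then show ?thesis by (intro in_sections_eq[of _ 0 1 2 "- 1"]) simp
  next
    case 3
    define c where "c = int (word 0 ! (k + j - R 3))"
    have "int (z (k * i + j)) = c + (int (z j) - c) * start i" for i
    proof (cases i)
      case 0
      then show ?thesis by (simp add: start_def)
    next
      case (Suc i')
      have "k * i + j = R 3 + k * i' + (k + j - R 3)" using k_gt by (simp add: Suc)
      moreover have "Suc (k + j - R 3) < k" using 3 k_gt by linarith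
      ultimately have "z (k * i + j) = word 0 ! (k + j - R 3)" using z_other by (simp only:)
      then show ?thesis by (simp add: start_def Suc c_def)
    qed
    then show ?thesis by (intro in_sections_eq[of _ 0 0 c "int (z j) - c"]) simp
  qed
qed

lemma delayed_section: "j < k \<Longrightarrow> (\<lambda>i. delayed (k * i + j)) \<in> sections"
proof (cases j)
  case 0
  define c where "c = int (word 0 ! (k - 1 - R 3))"
  have "delayed (k * i) = c + (- c) * start i" for i
  proof (cases i)
    case (Suc i')
    \<comment> \<open>Since R 3 > 0, this position is not the end of its block, so its letter is
      constant.\<close>
    have "k * i - 1 = R 3 + k * i' + (k - 1 - R 3)" "k * i \<noteq> 0" using k_gt by (simp_all add: Suc)
    moreover have "0 < R 3" using x by (simp add: R_3)
    ultimately show ?thesis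
      using z_other[of "k - 1 - R 3" i'] k_gt by (simp add: delayed_def start_def Suc c_def)
  qed (simp add: delayed_def start_def)
  then show ?thesis using 0 by (intro in_sections_eq[of _ 0 0 c "- c"]) simp
next
  case (Suc j')
  assume "j < k"
  then have "(\<lambda>i. int (z (k * i + j'))) \<in> sections" using Suc by (intro z_section) simp
  then show ?thesis using Suc by (simp add: delayed_def)
qed

lemma sections_closed:
  assumes "f \<in> sections" "j < k" shows "(\<lambda>i. f (k * i + j)) \<in> sections"
  using assms(1) unfolding sections_def
proof (induction f rule: int_seq.span_induct_alt)
  case base
  then show ?case using int_seq.span_zero by (simp add: zero_fun_def)
next
  case (step c f g)
  have start_section: "(\<lambda>i. start (k * i + j)) \<in> sections"
    by (rule in_sections_eq[of _ 0 0 0 "start j"]) (use k_gt in \<open>simp add: start_def\<close>)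
  have "(\<lambda>i. f (k * i + j)) \<in> sections"
    using step(1) z_section[OF assms(2)] delayed_section[OF assms(2)]
      in_sections[of 0 0 1 0] start_section by auto
  then have "seq_scale c (\<lambda>i. f (k * i + j)) + (\<lambda>i. g (k * i + j)) \<in> sections"
    unfolding sections_def using step by (intro int_seq.span_add int_seq.span_scale)
  moreover have "seq_scale c (\<lambda>i. f (k * i + j)) + (\<lambda>i. g (k * i + j)) = (\<lambda>i. (seq_scale c f + g) (k * i + j))"
    by (simp add: fun_eq_iff seq_scale_def)
  ultimately show ?case unfolding sections_def by (simp only:)
qed

lemma sections_closed_power:
  "f \<in> sections \<Longrightarrow> j < k ^ e \<Longrightarrow> (\<lambda>i. f (k ^ e * i + j)) \<in> sections"
proof (induction e arbitrary: f j)
  case (Suc e)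
  have "j div k < k ^ e" using Suc.prems(2) k_gt by (simp add: less_mult_imp_div_less mult.commute)
  moreover have "(\<lambda>i. f (k * i + j mod k)) \<in> sections"
    using sections_closed[OF Suc.prems(1)] k_gt by simp
  ultimately have "(\<lambda>i. f (k * (k ^ e * i + j div k) + j mod k)) \<in> sections"
    using Suc.IH by blast
  moreover have "k * (k ^ e * i + j div k) + j mod k = k ^ Suc e * i + j" for i
    by (simp add: distrib_left mult.assoc)
  ultimately show ?case by simp
qed simp

lemma regular: "k_regular k (\<lambda>i. int (z i))"
proof -
  have "kernel k (\<lambda>i. int (z i)) \<subseteq> sections"
  proof
    fix g assume "g \<in> kernel k (\<lambda>i. int (z i))"
    then obtain e j where g: "g = (\<lambda>i. int (z (k ^ e * i + j)))" "j \<le> k ^ e - 1"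
      by (auto simp: kernel_def)
    have "0 < k ^ e" using k_gt by simp
    then have "j < k ^ e" using g(2) by linarith
    moreover have "(\<lambda>i. int (z i)) \<in> sections" using in_sections[of 1 0 0 0] by simp
    ultimately show "g \<in> sections" unfolding g(1) by (intro sections_closed_power)
  qed
  then have "int_seq.span (kernel k (\<lambda>i. int (z i))) \<subseteq> sections"
    unfolding sections_def by (intro int_seq.span_minimal int_seq.subspace_span)
  then show ?thesis unfolding k_regular_def sections_def
    by (intro finitely_generated_submodule[OF _ int_seq.subspace_span]) auto
qed

end

theorem theorem5p2:
  fixes a b :: nat
  assumes "0 < a" and "0 < b" and "coprime a b"
    and "9 / 7 < real a / real b" and "real a / real b < 4 / 3"
    and "gcd b 24 = 1"
  shows "(\<forall>n. length (phi a b (Num n)) = 24 * a - 15 * b)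
    \<and> w a b = smap tau (morph_fix (phi a b) ZeroPrime)
    \<and> 24 * a - 15 * b \<in> rho a b"
proof -
  have "real (9 * b) < real (7 * a)" "real (3 * a) < real (4 * b)"
    using assms by (simp_all add: field_simps)
  then have ineq: "9 * b < 7 * a" "3 * a < 4 * b" by (simp_all only: of_nat_less_iff)
  define x y where "x = 4 * b - 3 * a" and "y = 7 * a - 9 * b"
  have ab: "a = 9 * x + 4 * y" "b = 7 * x + 3 * y" using ineq by (simp_all add: x_def y_def)
  have k: "24 * a - 15 * b = 111 * x + 51 * y" by (simp add: ab)
  have "coprime b 24" using assms(6) by (rule iffD2[OF coprime_iff_gcd_eq_1])
  then have "coprime b (24 * a)" using assms(3) by (simp add: coprime_commute)
  then have cop: "coprime b (111 * x + 51 * y)"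
  proof -
    have "111 * x + 51 * y + 15 * b = 24 * a" by (simp add: ab)
    then have "d dvd 24 * a" if "d dvd b" "d dvd 111 * x + 51 * y" for d
      using that by (metis dvd_add dvd_mult)
    with \<open>coprime b (24 * a)\<close> show ?thesis by (auto simp: coprime_def)
  qed
  interpret exponent x y
  proof
    show "0 < x" "0 < y" using ineq by (simp_all add: x_def y_def)
    show "coprime (7 * x + 3 * y) (111 * x + 51 * y)" using cop by (simp only: ab(2)[symmetric])
  qed
  have "length (phi a b (Num n)) = 24 * a - 15 * b" for n
    by (simp add: phi_num_word[OF ab] word_length k_def k)
  moreover have "w a b = smap tau (morph_fix (phi a b) ZeroPrime)"
    unfolding morph_fix_letters[OF ab] by (rule w_letters[OF ab])
  moreover have "24 * a - 15 * b \<in> rho a b"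
  proof -
    have "2 \<le> 24 * a - 15 * b" using x by (simp add: k)
    moreover have "w a b !! i = z i" for i unfolding w_letters[OF ab] by (rule tau_letters)
    ultimately show ?thesis using regular by (simp add: rho_def k k_def)
  qed
  ultimately show ?thesis by blast
qed

end
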